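(* Every sum system $(\{G_{a,b}\}_{0\le a<b\le\infty},\{S_t\}_{t\ge 0})$ is divisible. That is, for every $s\in(0,\infty)$, $$G_{0,s}=\overline{\mathrm{span}_{\mathbb R}\{x_{s_1,s_2};\ (s_1,s_2)\subseteq(0,s),\ \{x_t\}\in R\mathcal{A}\mathcal{U}\}}$$ and $$G_{0,s}=\overline{\mathrm{span}_{\mathbb R}\{{}^s y'_{s_1,s_2};\ (s_1,s_2)\subseteq(0,s),\ \{y_t\}\in I\mathcal{A}\mathcal{U}\}},$$ where $R\mathcal{A}\mathcal{U}$ and $I\mathcal{A}\mathcal{U}$ are the sets of real and imaginary addits of the sum system.
   Context: For real Hilbert spaces $G_1,G_2$, $\mathcal S(G_1,G_2)$ denotes the set of bounded operators $A:G_1\to G_2$ with bounded inverse such that $I-A^*A$ is Hilbert-Schmidt. Sum system: a two-parameter family $\{G_{s,t}\}_{0\le s<t\le\infty}$ of closed subspaces of a real Hilbert space $G_{0,\infty}$ with $G_{s,t}\subset G_{s',t'}$ whenever $(s,t)\subset(s',t')$, together with a $C_0$-semigroup $\{S_t\}_{t\ge0}$ on $G_{0,\infty}$, such that for all $s\in(0,\infty)$ and $t\in(0,\infty]$: (1) the restriction of $S_s$ to $G_{0,t}$ belongs to $\mathcal S(G_{0,t},G_{s,s+t})$; (2) the map $A_{s,t}:G_{0,s}\oplus G_{s,s+t}\to G_{0,s+t}$, $A_{s,t}(x\oplus y)=x+y$ (orthogonal external direct sum), belongs to $\mathcal S(G_{0,s}\oplus G_{s,s+t},G_{0,s+t})$.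 Real addit: a family $\{x_t\}_{t\in(0,\infty)}$ with $x_t\in G_{0,t}$, such that $t\mapsto\langle x_t,x\rangle$ is measurable for every $x\in G_{0,\infty}$ and $x_s+S_sx_t=x_{s+t}$ for all $s,t>0$. $R\mathcal{A}\mathcal{U}$ is the set of all real addits. Imaginary addit: a family $\{y_t\}_{t\in(0,\infty)}$ with $y_t\in G_{0,t}$, such that $t\mapsto\langle y_t,y\rangle$ is measurable for every $y\in G_{0,\infty}$ and $(A_{s,t}^* )^{-1}(y_s\oplus(S_s^* )^{-1}y_t)=y_{s+t}$ for all $s,t>0$; here $S_s$ is regarded as an invertible operator from $G_{0,t}$ onto $G_{s,s+t}$, so $(S_s^* )^{-1}:G_{0,t}\to G_{s,s+t}$. $I\mathcal{A}\mathcal{U}$ is the set of all imaginary addits. For a real addit, $x_{s,t}=S_s(x_{t-s})\in G_{s,t}$. For an imaginary addit, $y_{s,t}=(S_s^* )^{-1}(y_{t-s})\in G_{s,t}$, with $S_s$ regarded as an invertible operator $G_{0,t-s}\to G_{s,t}$. For $(s_1,s_2)\subset(0,s)$, ${}^sy'_{s_1,s_2}=(\tilde A^* )^{-1}(0\oplus y_{s_1,s_2}\oplus0)\in G_{0,s}$, where $\tilde A:G_{0,s_1}\oplus G_{s_1,s_2}\oplus G_{s_2,s}\to G_{0,s}$ is $x\oplus y\oplus z\mapsto x+y+z$ (summands attached to empty intervals are $\{0\}$). *)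

theory Defs
  imports "HOL-Analysis.Analysis"
begin

section \<open>Operators between closed subspaces\<close>

text \<open>
  Hilbert spaces are closed subspaces \<open>G\<close> of a complete inner product type. An operator
  \<open>G1 \<rightarrow> G2\<close> is a function on the ambient types of which only the values on \<open>G1\<close> matter.
  The external orthogonal direct sum of \<open>G\<close> and \<open>H\<close> is \<open>G \<times> H\<close>, with the inner product
  of the product type.
\<close>

definition closed_subspace :: "'a::real_inner set \<Rightarrow> bool" where
  "closed_subspace G \<longleftrightarrow> subspace G \<and> closed G"

definition bounded_op :: "'a::real_inner set \<Rightarrow> 'b::real_inner set \<Rightarrow> ('a \<Rightarrow> 'b) \<Rightarrow> bool" where
  "bounded_op G1 G2 A \<longleftrightarrow>
     A ` G1 \<subseteq> G2 \<and>
     (\<forall>x\<in>G1. \<forall>y\<in>G1. A (x + y) = A x + A y) \<and>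
     (\<forall>c. \<forall>x\<in>G1. A (c *\<^sub>R x) = c *\<^sub>R A x) \<and>
     (\<exists>K. \<forall>x\<in>G1. norm (A x) \<le> K * norm x)"

text \<open>The Hilbert space adjoint \<open>G2 \<rightarrow> G1\<close> of \<open>A : G1 \<rightarrow> G2\<close>; for bounded \<open>A\<close> and complete
  \<open>G1\<close> the described vector exists and is unique by the Riesz theorem.\<close>

definition adj :: "'a::real_inner set \<Rightarrow> 'b::real_inner set \<Rightarrow> ('a \<Rightarrow> 'b) \<Rightarrow> 'b \<Rightarrow> 'a" where
  "adj G1 G2 A y = (THE z. z \<in> G1 \<and> (\<forall>x\<in>G1. A x \<bullet> y = x \<bullet> z))"

text \<open>\<open>(A\<^sup>*)\<^sup>-\<^sup>1 : G1 \<rightarrow> G2\<close>\<close>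

definition inv_adj :: "'a::real_inner set \<Rightarrow> 'b::real_inner set \<Rightarrow> ('a \<Rightarrow> 'b) \<Rightarrow> 'a \<Rightarrow> 'b" where
  "inv_adj G1 G2 A = inv_into G2 (adj G1 G2 A)"

definition orthonormal_basis :: "'a::real_inner set \<Rightarrow> 'a set \<Rightarrow> bool" where
  "orthonormal_basis G E \<longleftrightarrow>
     E \<subseteq> G \<and> pairwise orthogonal E \<and> (\<forall>e\<in>E. norm e = 1) \<and> closure (span E) = G"

definition hilbert_schmidt :: "'a::real_inner set \<Rightarrow> 'b::real_inner set \<Rightarrow> ('a \<Rightarrow> 'b) \<Rightarrow> bool" where
  "hilbert_schmidt G1 G2 T \<longleftrightarrow>
     bounded_op G1 G2 T \<and>
     (\<exists>E. orthonormal_basis G1 E \<and> (\<lambda>e. (norm (T e))\<^sup>2) summable_on E)"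

text \<open>The class \<open>\<S>(G1, G2)\<close>\<close>

definition S_class :: "'a::real_inner set \<Rightarrow> 'b::real_inner set \<Rightarrow> ('a \<Rightarrow> 'b) set" where
  "S_class G1 G2 = {A. bounded_op G1 G2 A \<and>
     bij_betw A G1 G2 \<and> bounded_op G2 G1 (inv_into G1 A) \<and>
     hilbert_schmidt G1 G1 (\<lambda>x. x - adj G1 G2 A (A x))}"


section \<open>Sum systems\<close>

definition C0_semigroup :: "(real \<Rightarrow> 'a::real_inner \<Rightarrow> 'a) \<Rightarrow> bool" where
  "C0_semigroup S \<longleftrightarrow>
     (\<forall>t\<ge>0. bounded_linear (S t)) \<and>
     (\<forall>x. S 0 x = x) \<and>
     (\<forall>s\<ge>0. \<forall>t\<ge>0. \<forall>x. S (s + t) x = S s (S t x)) \<and>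
     (\<forall>x. ((\<lambda>t. S t x) \<longlongrightarrow> x) (at_right 0))"

text \<open>\<open>G s t\<close> is meaningful only for \<open>0 \<le> s < t \<le> \<infinity>\<close>; the space \<open>G 0 \<infinity>\<close> is the whole type.\<close>

definition sum_system ::
  "(real \<Rightarrow> ereal \<Rightarrow> 'a::{real_inner,complete_space} set) \<Rightarrow> (real \<Rightarrow> 'a \<Rightarrow> 'a) \<Rightarrow> bool" where
  "sum_system G S \<longleftrightarrow>
     G 0 \<infinity> = UNIV \<and>
     (\<forall>s t. 0 \<le> s \<longrightarrow> ereal s < t \<longrightarrow> closed_subspace (G s t)) \<and>
     (\<forall>s t s' t'. 0 \<le> s' \<longrightarrow> s' \<le> s \<longrightarrow> ereal s < t \<longrightarrow> t \<le> t' \<longrightarrow> G s t \<subseteq> G s' t') \<and>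
     C0_semigroup S \<and>
     (\<forall>s>0. \<forall>t>0. S s \<in> S_class (G 0 t) (G s (ereal s + t))) \<and>
     (\<forall>s>0. \<forall>t>0. (\<lambda>(x, y). x + y) \<in>
        S_class (G 0 (ereal s) \<times> G s (ereal s + t)) (G 0 (ereal s + t)))"


section \<open>Addits\<close>

text \<open>A family indexed by \<open>(0, \<infinity>)\<close> is a function on the reals whose values outside
  \<open>(0, \<infinity>)\<close> are irrelevant.\<close>

definition weakly_measurable :: "(real \<Rightarrow> 'a::real_inner) \<Rightarrow> bool" where
  "weakly_measurable x \<longleftrightarrow>
     (\<forall>v. (\<lambda>t. x t \<bullet> v) \<in> borel_measurable (restrict_space borel {0<..}))"

definition real_addits ::
  "(real \<Rightarrow> ereal \<Rightarrow> 'a::real_inner set) \<Rightarrow> (real \<Rightarrow> 'a \<Rightarrow> 'a) \<Rightarrow> (real \<Rightarrow> 'a) set" where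
  "real_addits G S = {x.
     (\<forall>t>0. x t \<in> G 0 (ereal t)) \<and> weakly_measurable x \<and>
     (\<forall>s>0. \<forall>t>0. x s + S s (x t) = x (s + t))}"

text \<open>\<open>x\<^bsub>s,t\<^esub>\<close> for a real and \<open>y\<^bsub>s,t\<^esub>\<close> for an imaginary addit\<close>

definition real_incr :: "(real \<Rightarrow> 'a \<Rightarrow> 'a) \<Rightarrow> (real \<Rightarrow> 'a) \<Rightarrow> real \<Rightarrow> real \<Rightarrow> 'a" where
  "real_incr S x s t = S s (x (t - s))"

definition imag_incr ::
  "(real \<Rightarrow> ereal \<Rightarrow> 'a::real_inner set) \<Rightarrow> (real \<Rightarrow> 'a \<Rightarrow> 'a) \<Rightarrow> (real \<Rightarrow> 'a) \<Rightarrow> real \<Rightarrow> real \<Rightarrow> 'a"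
where
  "imag_incr G S y s t = inv_adj (G 0 (ereal (t - s))) (G s (ereal t)) (S s) (y (t - s))"

definition imag_addits ::
  "(real \<Rightarrow> ereal \<Rightarrow> 'a::real_inner set) \<Rightarrow> (real \<Rightarrow> 'a \<Rightarrow> 'a) \<Rightarrow> (real \<Rightarrow> 'a) set" where
  "imag_addits G S = {y.
     (\<forall>t>0. y t \<in> G 0 (ereal t)) \<and> weakly_measurable y \<and>
     (\<forall>s>0. \<forall>t>0.
        inv_adj (G 0 (ereal s) \<times> G s (ereal (s + t))) (G 0 (ereal (s + t))) (\<lambda>(u, v). u + v)
          (y s, inv_adj (G 0 (ereal t)) (G s (ereal (s + t))) (S s) (y t)) = y (s + t))}"

text \<open>The summand attached to an empty interval is \<open>{0}\<close>.\<close>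

definition summand :: "(real \<Rightarrow> ereal \<Rightarrow> 'a::real_inner set) \<Rightarrow> real \<Rightarrow> real \<Rightarrow> 'a set" where
  "summand G s t = (if s < t then G s (ereal t) else {0})"

text \<open>\<open>\<^sup>sy'\<close> with indices \<open>s1, s2\<close>\<close>

definition imag_incr' ::
  "(real \<Rightarrow> ereal \<Rightarrow> 'a::real_inner set) \<Rightarrow> (real \<Rightarrow> 'a \<Rightarrow> 'a) \<Rightarrow> real \<Rightarrow> (real \<Rightarrow> 'a) \<Rightarrow>
    real \<Rightarrow> real \<Rightarrow> 'a" where
  "imag_incr' G S s y s1 s2 =
     inv_adj (summand G 0 s1 \<times> summand G s1 s2 \<times> summand G s2 s) (G 0 (ereal s))
       (\<lambda>(u, v, w). u + v + w) (0, imag_incr G S y s1 s2, 0)"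

definition divisible ::
  "(real \<Rightarrow> ereal \<Rightarrow> 'a::real_inner set) \<Rightarrow> (real \<Rightarrow> 'a \<Rightarrow> 'a) \<Rightarrow> bool" where
  "divisible G S \<longleftrightarrow> (\<forall>s>0.
     G 0 (ereal s) = closure (span
       {real_incr S x s1 s2 | x s1 s2. 0 \<le> s1 \<and> s1 < s2 \<and> s2 \<le> s \<and> x \<in> real_addits G S}) \<and>
     G 0 (ereal s) = closure (span
       {imag_incr' G S s y s1 s2 | y s1 s2. 0 \<le> s1 \<and> s1 < s2 \<and> s2 \<le> s \<and> y \<in> imag_addits G S}))"

end

(*
  The projection P_t of G_{0,oo} = G_{0,t} + G_{t,oo} onto the second summand yields bounded left
  inverses R_t = S_t^{-1} P_t of S_t with kernel G_{0,t}. They form a semigroup, which is strongly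
  continuous because R_t = R_1 S_{1-t}. If w lies in the domain of the generator B of R, then
  x_t = S_t w - w + int_0^t S_r B w dr satisfies x_{s+t} = x_s + S_s x_t and R_t x_t = 0, so x is a
  real addit. Up to o(d) one has x_d = S_d R_d w - w; hence the telescoping sum
    w - S_s R_s w = sum_{k<n} S_{kd} (1 - S_d R_d) R_{kd} w,   d = s/n,
  is approximated by sums of increments of addits, and w - S_s R_s w ranges over a dense subset of
  G_{0,s}. The same argument for the adjoint semigroups R^* and S^* gives the imaginary addits:
  with E_t the orthogonal projection onto G_{0,t}, the family E_t y_t is an imaginary addit for
  every y with y_{s+t} = y_s + R_s^* y_t and S_t^* y_t = 0.
*)

theory Submission
  imports Defs
begin

section \<open>Hilbert space preliminaries\<close>

text \<open>The correction term in the addit formula is forced. The family S_t w - w is additive,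
  but R_t maps it to w - R_t w instead of 0. An integral int_0^t S_r u dr is additive too, and R_t
  maps it to int_0^t R_r u dr. The two images cancel exactly when this integral equals R_t w - w,
  that is, when u = B w. Averages int_0^h R_r z dr supply a dense set of such w. The obstacle in the
  telescoping sum is uniformity: s/d errors are added, so each must be o(d) with one modulus. Since
  B commutes with R_a, the k-th defect is the first one with R_{kd} w in place of w, and a single
  uniform continuity argument on a square serves all k. Imaginary addits become accessible once a
  vector is read as the functional it represents. Inverse adjoints of sum maps glue functionals
  given on the summands, so the increment with a prime is an extension by zero. In this reading the
  adjoint of R_s shifts a functional and makes it vanish on G_{0,s}, and being killed by the adjoint
  of S_t means vanishing on G_{t,oo}.\<close>

lemma orthogonal_decomposition:
  fixes X :: "'a::{real_inner,complete_space} set"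
  assumes X: "closed_subspace X"
  shows "\<exists>p\<in>X. \<forall>x\<in>X. (z - p) \<bullet> x = 0"
proof -
  have sub: "subspace X" and cl: "closed X" using X by (auto simp: closed_subspace_def)
  have "0 \<in> X" using sub by (rule subspace_0)
  define D where "D = (INF x\<in>X. (norm (z - x))\<^sup>2)"
  have bdd: "bdd_below ((\<lambda>x. (norm (z - x))\<^sup>2) ` X)" by (rule bdd_belowI[of _ 0]) auto
  have D_le: "D \<le> (norm (z - x))\<^sup>2" if "x \<in> X" for x
    unfolding D_def by (rule cINF_lower[OF bdd that])
  have "\<exists>a\<in>X. (norm (z - a))\<^sup>2 < D + 1 / real (Suc n)" for n
  proof -
    have "(INF x\<in>X. (norm (z - x))\<^sup>2) < D + 1 / real (Suc n)" by (simp add: D_def)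
    then show ?thesis using \<open>0 \<in> X\<close> by (subst (asm) cINF_less_iff[OF _ bdd]) auto
  qed
  then obtain a where aX: "\<And>n. a n \<in> X"
    and a: "\<And>n. (norm (z - a n))\<^sup>2 < D + 1 / real (Suc n)" by metis
  \<comment> \<open>Parallelogram law for \<open>z - a m\<close> and \<open>z - a n\<close>: the
    midpoint of \<open>a m\<close> and \<open>a n\<close> lies in \<open>X\<close>, so its squared
    distance to \<open>z\<close> is at least \<open>D\<close>, which leaves little room for
    \<open>a m - a n\<close>.\<close>
  have dist_a: "(norm (a m - a n))\<^sup>2 \<le> 2 / real (Suc m) + 2 / real (Suc n)" for m n
  proof -
    have "(1/2) *\<^sub>R (a m + a n) \<in> X" by (intro subspace_scale[OF sub] subspace_add[OF sub] aX)
    then have "D \<le> (norm (z - (1/2) *\<^sub>R (a m + a n)))\<^sup>2" by (rule D_le)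
    moreover have "(norm (a m - a n))\<^sup>2 + 4 * (norm (z - (1/2) *\<^sub>R (a m + a n)))\<^sup>2
        = 2 * (norm (z - a m))\<^sup>2 + 2 * (norm (z - a n))\<^sup>2"
      unfolding power2_norm_eq_inner by (simp add: inner_simps inner_commute field_simps)
    moreover have "2 / real (Suc k) = 2 * (1 / real (Suc k))" for k by simp
    ultimately show ?thesis using a[of m] a[of n] by linarith
  qed
  have "Cauchy a"
  proof (rule metric_CauchyI)
    fix e :: real assume "0 < e"
    then have "0 < e\<^sup>2" by simp
    then obtain N where N: "inverse (real (Suc N)) < e\<^sup>2 / 4"
      using reals_Archimedean[of "e\<^sup>2 / 4"] by auto
    have "dist (a m) (a n) < e" if "N \<le> m" "N \<le> n" for m n
    proof -
      have "2 / real (Suc k) \<le> 2 / real (Suc N)" if "N \<le> k" for k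
        by (rule divide_left_mono) (use that in auto)
      with dist_a[of m n] that
      have "(norm (a m - a n))\<^sup>2 \<le> 2 / real (Suc N) + 2 / real (Suc N)" by (smt (verit))
      also have "\<dots> = 4 * inverse (real (Suc N))" by (simp add: divide_inverse)
      also have "\<dots> < e\<^sup>2" using N by linarith
      finally show ?thesis using \<open>0 < e\<close> by (simp add: dist_norm power2_less_imp_less)
    qed
    then show "\<exists>N. \<forall>m\<ge>N. \<forall>n\<ge>N. dist (a m) (a n) < e" by blast
  qed
  then obtain p where p: "a \<longlonglongrightarrow> p" by (auto simp: Cauchy_convergent_iff convergent_def)
  have "p \<in> X" using closed_sequentially[OF cl _ p] aX by auto
  have "(\<lambda>n. (norm (z - a n))\<^sup>2) \<longlonglongrightarrow> (norm (z - p))\<^sup>2" by (intro tendsto_intros p)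
  moreover have "(\<lambda>n. D + 1 / real (Suc n)) \<longlonglongrightarrow> D + 0"
    by (intro tendsto_intros) (use LIMSEQ_inverse_real_of_nat in \<open>simp add: field_simps\<close>)
  ultimately have "(norm (z - p))\<^sup>2 \<le> D + 0"
    by (rule LIMSEQ_le) (use a less_imp_le in blast)
  then have p_le: "(norm (z - p))\<^sup>2 \<le> (norm (z - x))\<^sup>2" if "x \<in> X" for x using D_le[OF that] by linarith
  have "(z - p) \<bullet> x = 0" if "x \<in> X" for x
  proof (cases "x = 0")
    case False
    \<comment> \<open>The minimiser of the quadratic polynomial c -> |z - p - c x|^2; minimality of
      \<open>p\<close> then forces the linear coefficient to vanish.\<close>
    define c where "c = (z - p) \<bullet> x / (x \<bullet> x)"
    have xx: "x \<bullet> x > 0" using False by simp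
    have "p + c *\<^sub>R x \<in> X" by (intro subspace_scale[OF sub] subspace_add[OF sub] \<open>p \<in> X\<close> that)
    from p_le[OF this]
    have "(z - p) \<bullet> (z - p) \<le> (z - p - c *\<^sub>R x) \<bullet> (z - p - c *\<^sub>R x)"
      by (simp add: power2_norm_eq_inner algebra_simps)
    also have "\<dots> = (z - p) \<bullet> (z - p) - 2 * c * ((z - p) \<bullet> x) + c\<^sup>2 * (x \<bullet> x)"
      by (simp add: inner_diff inner_commute power2_eq_square algebra_simps)
    also have "\<dots> = (z - p) \<bullet> (z - p) - ((z - p) \<bullet> x)\<^sup>2 / (x \<bullet> x)"
      using xx unfolding c_def by (simp add: power2_eq_square)
    finally have "((z - p) \<bullet> x)\<^sup>2 / (x \<bullet> x) \<le> 0" by simp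
    then show ?thesis using xx by (simp add: divide_le_0_iff)
  qed simp
  then show ?thesis using \<open>p \<in> X\<close> by blast
qed

text \<open>Total on the ambient type, so that it can extend functionals from \<open>X\<close> to
  the whole space. The choice is unique for a closed subspace, by \<open>proj_eqI\<close>.\<close>

definition proj :: "'a::real_inner set \<Rightarrow> 'a \<Rightarrow> 'a" where
  "proj X z = (SOME p. p \<in> X \<and> (\<forall>x\<in>X. (z - p) \<bullet> x = 0))"

context
  fixes X :: "'a::{real_inner,complete_space} set"
  assumes X: "closed_subspace X"
begin

lemma proj_in: "proj X z \<in> X"
  and inner_proj: "x \<in> X \<Longrightarrow> x \<bullet> proj X z = x \<bullet> z"
proof -
  have "\<exists>p. p \<in> X \<and> (\<forall>x\<in>X. (z - p) \<bullet> x = 0)" using orthogonal_decomposition[OF X] by blast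
  from someI_ex[OF this]
  have *: "proj X z \<in> X" "\<forall>x\<in>X. (z - proj X z) \<bullet> x = 0" by (auto simp: proj_def)
  show "proj X z \<in> X" by fact
  show "x \<bullet> proj X z = x \<bullet> z" if "x \<in> X"
    using *(2) that by (simp add: inner_diff inner_commute)
qed

lemma proj_eqI:
  assumes "p \<in> X" "\<And>x. x \<in> X \<Longrightarrow> x \<bullet> p = x \<bullet> z"
  shows "proj X z = p"
proof -
  have "proj X z - p \<in> X"
    using X assms(1) proj_in by (simp add: closed_subspace_def subspace_diff)
  then have "(proj X z - p) \<bullet> (proj X z - p) = 0"
    using assms(2) inner_proj by (simp add: inner_diff(2))
  then show ?thesis by simp
qed

lemma proj_self: "z \<in> X \<Longrightarrow> proj X z = z"
  by (rule proj_eqI) auto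

lemma norm_proj_le: "norm (proj X z) \<le> norm z"
proof -
  have "norm (proj X z) * norm (proj X z) = proj X z \<bullet> z"
    using inner_proj[OF proj_in, of z z] by (simp flip: power2_norm_eq_inner add: power2_eq_square)
  also have "\<dots> \<le> norm (proj X z) * norm z" by (rule norm_cauchy_schwarz)
  finally show ?thesis by (metis mult_le_cancel_left_pos norm_ge_zero norm_le_zero_iff not_less order.trans)
qed

lemma bounded_linear_proj: "bounded_linear (proj X)"
proof (rule bounded_linear_intro[where K = 1])
  have sub: "subspace X" using X by (simp add: closed_subspace_def)
  show "proj X (x + y) = proj X x + proj X y" for x y
    by (rule proj_eqI) (auto simp: inner_proj inner_add_right intro: subspace_add[OF sub] proj_in)
  show "proj X (c *\<^sub>R x) = c *\<^sub>R proj X x" for c x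
    by (rule proj_eqI) (auto simp: inner_proj intro: subspace_scale[OF sub] proj_in)
  show "norm (proj X x) \<le> norm x * 1" for x using norm_proj_le by simp
qed

end

lemma proj_proj_subset:
  fixes X Y :: "'a::{real_inner,complete_space} set"
  assumes "closed_subspace X" "closed_subspace Y" "X \<subseteq> Y"
  shows "proj X (proj Y z) = proj X z"
  by (rule proj_eqI[OF assms(1)])
    (use assms in \<open>auto simp: proj_in inner_proj dest: subsetD\<close>)

text \<open>The kernel of a nonzero \<open>f\<close> has codimension one. The component
  \<open>q\<close>, orthogonal to the kernel, of a vector outside it represents \<open>f\<close>
  after rescaling.\<close>

theorem riesz_representation:
  fixes f :: "'a::{real_inner,complete_space} \<Rightarrow> real"
  assumes f: "bounded_linear f"
  obtains r where "\<And>x. f x = x \<bullet> r"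
proof (cases "\<forall>x. f x = 0")
  case True
  then show ?thesis using that[of 0] by simp
next
  case False
  then obtain z where z: "f z \<noteq> 0" by blast
  interpret f: bounded_linear f by fact
  define K where "K = {x. f x = 0}"
  have K: "closed_subspace K"
    unfolding closed_subspace_def K_def
  proof
    show "subspace {x. f x = 0}" by (auto simp: subspace_def f.add f.scaleR)
    show "closed {x. f x = 0}"
      by (intro closed_Collect_eq continuous_intros linear_continuous_on f)
  qed
  define q where "q = z - proj K z"
  have fp: "f (proj K z) = 0" using proj_in[OF K, of z] by (simp add: K_def)
  then have fq: "f q = f z" by (simp add: q_def f.diff)
  have orth: "x \<bullet> q = 0" if "f x = 0" for x
    using inner_proj[OF K, of x z] that by (simp add: K_def q_def inner_diff)
  have "q \<noteq> 0" using fq z f.zero by auto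
  show ?thesis
  proof (rule that[of "(f q / (q \<bullet> q)) *\<^sub>R q"])
    fix x
    have "f (x - (f x / f q) *\<^sub>R q) = 0" using fq z by (simp add: f.diff f.scaleR)
    from orth[OF this] have "x \<bullet> q = f x / f q * (q \<bullet> q)" by (simp add: inner_diff)
    then show "f x = x \<bullet> (f q / (q \<bullet> q)) *\<^sub>R q" using \<open>q \<noteq> 0\<close> fq z by simp
  qed
qed

text \<open>\<open>adjoint\<close> is a choice among the functions with this property; the Riesz
  theorem shows that one exists.\<close>

lemma inner_adjoint:
  fixes A :: "'a::{real_inner,complete_space} \<Rightarrow> 'b::real_inner"
  assumes A: "bounded_linear A"
  shows "x \<bullet> adjoint A y = A x \<bullet> y"
proof -
  have "\<exists>r. \<forall>x. A x \<bullet> y = x \<bullet> r" for y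
    using riesz_representation[of "\<lambda>x. A x \<bullet> y"]
      bounded_linear_compose[OF bounded_linear_inner_left A] by blast
  then have "\<exists>g. \<forall>x y. A x \<bullet> y = x \<bullet> g y" by metis
  from someI_ex[OF this] have "\<forall>x y. A x \<bullet> y = x \<bullet> adjoint A y"
    unfolding adjoint_def .
  then show ?thesis by simp
qed

text \<open>The constant \<open>B\<close> is kept explicit so that a bound for \<open>S t\<close>
  uniform in \<open>t\<close> passes unchanged to the adjoints.\<close>

lemma norm_adjoint_le:
  fixes A :: "'a::{real_inner,complete_space} \<Rightarrow> 'b::real_inner"
  assumes A: "bounded_linear A" and B: "\<And>x. norm (A x) \<le> B * norm x" "0 \<le> B"
  shows "norm (adjoint A y) \<le> B * norm y"
proof (cases "adjoint A y = 0")
  case True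
  then show ?thesis using \<open>0 \<le> B\<close> by simp
next
  case False
  have "norm (adjoint A y) * norm (adjoint A y) = A (adjoint A y) \<bullet> y"
    using inner_adjoint[OF A, of "adjoint A y" y] by (simp flip: power2_norm_eq_inner add: power2_eq_square)
  also have "\<dots> \<le> norm (A (adjoint A y)) * norm y" by (rule norm_cauchy_schwarz)
  also have "\<dots> \<le> B * norm (adjoint A y) * norm y" by (intro mult_right_mono B) simp
  finally show ?thesis using False by simp
qed

text \<open>Baire category: the closed sets \<open>C n\<close> cover the space, so one of them
  contains a ball, and differences of its points carry the bound to a ball around 0.\<close>

lemma uniform_boundedness:
  fixes F :: "'i \<Rightarrow> 'a::{real_normed_vector,complete_space} \<Rightarrow> 'b::real_normed_vector"
  assumes lin: "\<And>i. i \<in> J \<Longrightarrow> bounded_linear (F i)"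
    and pw: "\<And>x. \<exists>B. \<forall>i\<in>J. norm (F i x) \<le> B"
  obtains B where "0 \<le> B" "\<And>i x. i \<in> J \<Longrightarrow> norm (F i x) \<le> B * norm x"
proof -
  define C where "C n = {x. \<forall>i\<in>J. norm (F i x) \<le> real n}" for n
  have cont: "continuous_on UNIV (F i)" if "i \<in> J" for i
    using lin[OF that] by (rule linear_continuous_on)
  have "C n = (\<Inter>i\<in>J. {x. norm (F i x) \<le> real n})" for n by (auto simp: C_def)
  then have closedC: "closed (C n)" for n
    by (auto intro!: closed_INT closed_Collect_le continuous_intros cont)
  have UC: "(\<Union>n. C n) = UNIV"
  proof -
    have "\<exists>n. x \<in> C n" for x
    proof -
      obtain B where B: "\<forall>i\<in>J. norm (F i x) \<le> B" using pw by blast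
      obtain n where "B \<le> real n" using real_arch_simple by blast
      then have "x \<in> C n" using B by (fastforce simp: C_def)
      then show ?thesis ..
    qed
    then show ?thesis by auto
  qed
  have "\<exists>n. interior (C n) \<noteq> {}"
  proof (rule ccontr)
    assume "\<not> (\<exists>n. interior (C n) \<noteq> {})"
    then have "(euclidean :: 'a topology) interior_of \<Union>(range C) = {}"
      by (intro Baire_category_alt) (auto simp: completely_metrizable_space_euclidean closedC)
    then show False using UC by simp
  qed
  then obtain n x0 e where e: "0 < e" "ball x0 e \<subseteq> C n" by (auto simp: mem_interior)
  have small: "norm (F i y) \<le> 2 * real n" if "i \<in> J" "norm y < e" for i y
  proof -
    interpret bounded_linear "F i" using lin[OF that(1)] .
    have "x0 + y \<in> C n" "x0 \<in> C n" using e that by (auto simp: subset_iff dist_norm)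
    then have "norm (F i (x0 + y)) \<le> real n" "norm (F i x0) \<le> real n" using that by (auto simp: C_def)
    moreover have "F i y = F i (x0 + y) - F i x0" by (simp add: add)
    ultimately show ?thesis using norm_triangle_ineq4[of "F i (x0 + y)" "F i x0"] by simp
  qed
  have "norm (F i x) \<le> 4 * real n / e * norm x" if "i \<in> J" for i x
  proof (cases "x = 0")
    case True
    then show ?thesis using lin[OF that] by (simp add: linear_simps)
  next
    case False
    interpret bounded_linear "F i" using lin[OF that] .
    \<comment> \<open>Rescaling to norm e/2 puts the vector strictly inside the ball where
      \<open>small\<close> applies; this is the origin of the factor 4 n / e.\<close>
    have "norm (F i ((e / (2 * norm x)) *\<^sub>R x)) \<le> 2 * real n"
      by (rule small[OF that]) (use e False in simp)
    then have "e / (2 * norm x) * norm (F i x) \<le> 2 * real n" using e by (simp add: scaleR)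
    then show ?thesis using e False by (simp add: field_simps)
  qed
  then show ?thesis using e by (intro that[of "4 * real n / e"]) auto
qed

section \<open>Weak integrals\<close>

text \<open>The class \<open>banach\<close> is not available for the type of the theorem, so integrals of vector-valued
  functions are taken weakly.\<close>

definition weak_integral :: "real \<Rightarrow> (real \<Rightarrow> 'a::real_inner) \<Rightarrow> 'a" where
  "weak_integral t f = (SOME I. \<forall>v. I \<bullet> v = integral {0..t} (\<lambda>r. f r \<bullet> v))"

text \<open>The norm bound makes the integrated pairing a bounded functional of \<open>v\<close>, as
  the Riesz theorem requires. Strong continuity would be too much to ask: orbits of the adjoint
  semigroup must qualify before their continuity at 0 is known.\<close>

definition weakly_continuous :: "real \<Rightarrow> (real \<Rightarrow> 'a::real_inner) \<Rightarrow> bool" where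
  "weakly_continuous t f \<longleftrightarrow> (\<forall>v. continuous_on {0..t} (\<lambda>r. f r \<bullet> v)) \<and>
     (\<exists>B. \<forall>r\<in>{0..t}. norm (f r) \<le> B)"

lemma weakly_continuous_subset: "weakly_continuous t f \<Longrightarrow> s \<le> t \<Longrightarrow> weakly_continuous s f"
  unfolding weakly_continuous_def
  by (metis atLeastatMost_subset_iff continuous_on_subset order_refl subset_eq)

lemma continuous_imp_weakly_continuous:
  assumes "continuous_on {0..t} f"
  shows "weakly_continuous t f"
proof -
  have "compact (f ` {0..t})" using assms by (intro compact_continuous_image) auto
  then have "bounded (f ` {0..t})" by (rule compact_imp_bounded)
  then show ?thesis
    unfolding weakly_continuous_def bounded_iff
    by (auto intro!: continuous_intros assms)
qed

lemma weak_integral_cong: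
  assumes "\<And>r. r \<in> {0..t} \<Longrightarrow> f r = g r"
  shows "weak_integral t f = weak_integral t g"
proof -
  have "integral {0..t} (\<lambda>r. f r \<bullet> v) = integral {0..t} (\<lambda>r. g r \<bullet> v)" for v
    by (rule integral_cong) (simp add: assms)
  then show ?thesis by (simp add: weak_integral_def)
qed

context
  fixes f :: "real \<Rightarrow> 'a::{real_inner,complete_space}" and t :: real
  assumes f: "weakly_continuous t f"
begin

lemma integrable_inner: "(\<lambda>r. f r \<bullet> v) integrable_on {0..t}"
  using f by (intro integrable_continuous_real) (simp add: weakly_continuous_def)

lemma inner_weak_integral: "weak_integral t f \<bullet> v = integral {0..t} (\<lambda>r. f r \<bullet> v)"
proof -
  obtain B where B: "\<And>r. r \<in> {0..t} \<Longrightarrow> norm (f r) \<le> B"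
    using f unfolding weakly_continuous_def by blast
  have "bounded_linear (\<lambda>v. integral {0..t} (\<lambda>r. f r \<bullet> v))"
  proof (rule bounded_linear_intro)
    show "integral {0..t} (\<lambda>r. f r \<bullet> (u + v)) =
        integral {0..t} (\<lambda>r. f r \<bullet> u) + integral {0..t} (\<lambda>r. f r \<bullet> v)" for u v
      by (simp add: inner_add_right integral_add integrable_inner)
    show "integral {0..t} (\<lambda>r. f r \<bullet> (c *\<^sub>R v)) = c *\<^sub>R integral {0..t} (\<lambda>r. f r \<bullet> v)" for c v
      by simp
    show "norm (integral {0..t} (\<lambda>r. f r \<bullet> v)) \<le> norm v * (\<bar>t\<bar> * \<bar>B\<bar>)" for v
    proof (cases "0 \<le> t")
      case True
      have "norm (integral {0..t} (\<lambda>r. f r \<bullet> v)) \<le> norm v * \<bar>B\<bar> * (t - 0)"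
      proof (rule integral_bound[OF True])
        show "norm (f r \<bullet> v) \<le> norm v * \<bar>B\<bar>" if "r \<in> {0..t}" for r
          using Cauchy_Schwarz_ineq2[of "f r" v] mult_right_mono[of "norm (f r)" "\<bar>B\<bar>" "norm v"]
            order.trans[OF B[OF that] abs_ge_self] by (simp add: mult.commute)
      qed (use f in \<open>simp add: weakly_continuous_def\<close>)
      then show ?thesis using True by (simp add: mult_ac)
    next
      case False
      then have "integral {0..t} (\<lambda>r. f r \<bullet> v) = 0" by simp
      then have "norm (integral {0..t} (\<lambda>r. f r \<bullet> v)) = 0" by (simp only: norm_zero)
      also have "\<dots> \<le> norm v * (\<bar>t\<bar> * \<bar>B\<bar>)" by simp
      finally show ?thesis .
    qed
  qed
  then obtain I where "\<And>v. integral {0..t} (\<lambda>r. f r \<bullet> v) = v \<bullet> I"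
    using riesz_representation by metis
  then have "\<exists>I. \<forall>v. I \<bullet> v = integral {0..t} (\<lambda>r. f r \<bullet> v)" by (auto simp: inner_commute)
  from someI_ex[OF this] have "\<forall>v. weak_integral t f \<bullet> v = integral {0..t} (\<lambda>r. f r \<bullet> v)"
    unfolding weak_integral_def .
  then show ?thesis by blast
qed

text \<open>Pairing the difference with itself reduces the claim to a scalar integral. The
  comparison vector \<open>y\<close> is 0 for norm bounds and the initial value of an orbit for
  averages.\<close>

lemma norm_weak_integral_diff_le:
  assumes "0 \<le> t" and B: "\<And>r. r \<in> {0..t} \<Longrightarrow> norm (f r - y) \<le> B"
  shows "norm (weak_integral t f - t *\<^sub>R y) \<le> t * B"
proof -
  define d where "d = weak_integral t f - t *\<^sub>R y"
  have "d \<bullet> d = integral {0..t} (\<lambda>r. f r \<bullet> d) - integral {0..t} (\<lambda>r. y \<bullet> d)"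
    using \<open>0 \<le> t\<close> by (simp add: d_def inner_diff_left inner_weak_integral)
  also have "\<dots> = integral {0..t} (\<lambda>r. (f r - y) \<bullet> d)"
    unfolding inner_diff_left
    by (rule integral_diff[symmetric]) (auto intro: integrable_inner)
  also have "\<dots> \<le> norm (integral {0..t} (\<lambda>r. (f r - y) \<bullet> d))" by simp
  also have "\<dots> \<le> norm d * B * (t - 0)"
  proof (rule integral_bound[OF \<open>0 \<le> t\<close>])
    show "norm ((f r - y) \<bullet> d) \<le> norm d * B" if "r \<in> {0..t}" for r
      using Cauchy_Schwarz_ineq2[of "f r - y" d] mult_right_mono[OF B[OF that], of "norm d"]
      by (simp add: mult.commute)
    next
    have "continuous_on {0..t} (\<lambda>r. f r \<bullet> d)" using f by (simp add: weakly_continuous_def)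
    then show "continuous_on {0..t} (\<lambda>r. (f r - y) \<bullet> d)"
      unfolding inner_diff_left by (rule continuous_on_diff) (rule continuous_on_const)
  qed
  finally have "norm d * norm d \<le> norm d * (t * B)"
    by (simp add: dot_square_norm power2_eq_square mult_ac)
  moreover have "0 \<le> t * B" using order.trans[OF norm_ge_zero B[of 0]] \<open>0 \<le> t\<close> by simp
  ultimately show ?thesis unfolding d_def[symmetric] by (cases "d = 0") auto
qed

end

lemma norm_weak_integral_le:
  fixes f :: "real \<Rightarrow> 'a::{real_inner,complete_space}"
  assumes "weakly_continuous t f" "0 \<le> t" "\<And>r. r \<in> {0..t} \<Longrightarrow> norm (f r) \<le> B"
  shows "norm (weak_integral t f) \<le> t * B"
  using norm_weak_integral_diff_le[OF assms(1,2), of 0 B] assms(3) by simp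

lemma weak_integral_eqI:
  fixes f :: "real \<Rightarrow> 'a::{real_inner,complete_space}"
  assumes "weakly_continuous t f" "\<And>v. I \<bullet> v = integral {0..t} (\<lambda>r. f r \<bullet> v)"
  shows "weak_integral t f = I"
  by (rule vector_eq_rdot[THEN iffD1]) (simp add: assms inner_weak_integral)

lemma weak_integral_diff:
  fixes f g :: "real \<Rightarrow> 'a::{real_inner,complete_space}"
  assumes f: "weakly_continuous t f" and g: "weakly_continuous t g"
  shows "weakly_continuous t (\<lambda>r. f r - g r)"
    and "weak_integral t (\<lambda>r. f r - g r) = weak_integral t f - weak_integral t g"
proof -
  obtain B C where "\<And>r. r \<in> {0..t} \<Longrightarrow> norm (f r) \<le> B" "\<And>r. r \<in> {0..t} \<Longrightarrow> norm (g r) \<le> C"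
    using f g unfolding weakly_continuous_def by blast
  then have "norm (f r - g r) \<le> B + C" if "r \<in> {0..t}" for r
    using norm_triangle_ineq4[of "f r" "g r"] that by (meson add_mono order.trans)
  moreover have "continuous_on {0..t} (\<lambda>r. (f r - g r) \<bullet> v)" for v
    unfolding inner_diff_left
    by (rule continuous_on_diff) (use f g in \<open>simp_all add: weakly_continuous_def\<close>)
  ultimately show wc: "weakly_continuous t (\<lambda>r. f r - g r)"
    unfolding weakly_continuous_def by blast
  show "weak_integral t (\<lambda>r. f r - g r) = weak_integral t f - weak_integral t g"
  proof (rule weak_integral_eqI[OF wc])
    fix v
    have "integral {0..t} (\<lambda>r. (f r - g r) \<bullet> v)
        = integral {0..t} (\<lambda>r. f r \<bullet> v) - integral {0..t} (\<lambda>r. g r \<bullet> v)"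
      unfolding inner_diff_left
      by (rule integral_diff) (intro integrable_inner f g)+
    then show "(weak_integral t f - weak_integral t g) \<bullet> v
        = integral {0..t} (\<lambda>r. (f r - g r) \<bullet> v)"
      by (simp add: inner_diff_left inner_weak_integral f g)
  qed
qed

text \<open>The adjoint moves \<open>A\<close> to the test vector, where the defining property of
  the weak integral applies.\<close>

lemma bounded_linear_weak_integral:
  fixes f :: "real \<Rightarrow> 'a::{real_inner,complete_space}" and A :: "'a \<Rightarrow> 'b::{real_inner,complete_space}"
  assumes f: "weakly_continuous t f" and A: "bounded_linear A"
  shows "weakly_continuous t (\<lambda>r. A (f r))"
    and "A (weak_integral t f) = weak_integral t (\<lambda>r. A (f r))"
proof -
  have A_adj: "A x \<bullet> v = x \<bullet> adjoint A v" for x v using inner_adjoint[OF A] by simp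
  obtain K where "0 \<le> K" and K: "\<And>x. norm (A x) \<le> norm x * K"
    using bounded_linear.nonneg_bounded[OF A] by blast
  obtain B where B: "\<forall>r\<in>{0..t}. norm (f r) \<le> B" using f by (auto simp: weakly_continuous_def)
  have "norm (A (f r)) \<le> B * K" if "r \<in> {0..t}" for r
    using K[of "f r"] mult_right_mono[OF B[rule_format, OF that] \<open>0 \<le> K\<close>] by simp
  with f show wc: "weakly_continuous t (\<lambda>r. A (f r))"
    unfolding weakly_continuous_def A_adj by blast
  show "A (weak_integral t f) = weak_integral t (\<lambda>r. A (f r))"
    by (rule weak_integral_eqI[OF wc, symmetric]) (simp add: A_adj inner_weak_integral[OF f])
qed

lemma weak_integral_reverse:
  fixes f :: "real \<Rightarrow> 'a::{real_inner,complete_space}"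
  assumes f: "weakly_continuous t f" and "0 \<le> t"
  shows "weakly_continuous t (\<lambda>r. f (t - r))" "weak_integral t (\<lambda>r. f (t - r)) = weak_integral t f"
proof -
  have "continuous_on {0..t} (\<lambda>r. f (t - r) \<bullet> v)" for v
  proof -
    have "continuous_on {0..t} ((\<lambda>r. f r \<bullet> v) \<circ> (\<lambda>r. t - r))"
      by (rule continuous_on_compose)
        (use f in \<open>auto intro!: continuous_intros simp: weakly_continuous_def\<close>)
    then show ?thesis by (simp add: o_def)
  qed
  moreover obtain B where "\<And>r. r \<in> {0..t} \<Longrightarrow> norm (f r) \<le> B"
    using f unfolding weakly_continuous_def by blast
  then have "norm (f (t - r)) \<le> B" if "r \<in> {0..t}" for r using that by simp
  ultimately show wc: "weakly_continuous t (\<lambda>r. f (t - r))"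
    unfolding weakly_continuous_def by blast
  show "weak_integral t (\<lambda>r. f (t - r)) = weak_integral t f"
  proof (rule weak_integral_eqI[OF wc])
    fix v
    have "((\<lambda>r. f r \<bullet> v) has_integral weak_integral t f \<bullet> v) {0..t}"
      using integrable_inner[OF f] by (simp add: inner_weak_integral[OF f] has_integral_integral)
    then have "((\<lambda>r. f (- r) \<bullet> v) has_integral weak_integral t f \<bullet> v) {-t..0}"
      by (auto dest: has_integral_reflect_lemma_real)
    then have "((\<lambda>r. f (- (r + (- t))) \<bullet> v) has_integral weak_integral t f \<bullet> v) {-t-(-t)..0-(-t)}"
      by (rule has_integral_shift_real_ivl)
    then show "weak_integral t f \<bullet> v = integral {0..t} (\<lambda>r. f (t - r) \<bullet> v)"
      by (simp add: integral_unique)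
  qed
qed

lemma weak_integral_shift:
  fixes f :: "real \<Rightarrow> 'a::{real_inner,complete_space}"
  assumes f: "weakly_continuous (s + t) f" and "0 \<le> s" "0 \<le> t"
  shows "weakly_continuous t (\<lambda>r. f (s + r))"
    "weak_integral t (\<lambda>r. f (s + r)) = weak_integral (s + t) f - weak_integral s f"
proof -
  have "continuous_on {0..t} (\<lambda>r. f (s + r) \<bullet> v)" for v
  proof -
    have "continuous_on {s..s+t} (\<lambda>r. f r \<bullet> v)"
      using f \<open>0 \<le> s\<close> unfolding weakly_continuous_def
      by (meson atLeastatMost_subset_iff continuous_on_subset order_refl)
    then have "continuous_on {0..t} ((\<lambda>r. f r \<bullet> v) \<circ> (\<lambda>r. s + r))"
      by (intro continuous_on_compose continuous_on_add continuous_on_const continuous_on_id)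
        (simp add: add.commute)
    then show ?thesis by (simp add: o_def)
  qed
  moreover obtain B where "\<And>r. r \<in> {0..s+t} \<Longrightarrow> norm (f r) \<le> B"
    using f unfolding weakly_continuous_def by blast
  then have "norm (f (s + r)) \<le> B" if "r \<in> {0..t}" for r using that \<open>0 \<le> s\<close> by simp
  ultimately show wc: "weakly_continuous t (\<lambda>r. f (s + r))"
    unfolding weakly_continuous_def by blast
  show "weak_integral t (\<lambda>r. f (s + r)) = weak_integral (s + t) f - weak_integral s f"
  proof (rule weak_integral_eqI[OF wc])
    fix v
    have s: "weakly_continuous s f" using f by (rule weakly_continuous_subset) (use assms in simp)
    have int: "(\<lambda>r. f r \<bullet> v) integrable_on {0..s+t}" using f by (rule integrable_inner)
    have "integral {0..s} (\<lambda>r. f r \<bullet> v) + integral {s..s+t} (\<lambda>r. f r \<bullet> v)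
        = integral {0..s+t} (\<lambda>r. f r \<bullet> v)"
      by (rule Henstock_Kurzweil_Integration.integral_combine[OF _ _ int]) (use assms in auto)
    moreover have "integral {s..s+t} (\<lambda>r. f r \<bullet> v) = integral {0..t} (\<lambda>r. f (s + r) \<bullet> v)"
    proof -
      have "(\<lambda>r. f r \<bullet> v) integrable_on {s..s+t}"
        using int by (rule integrable_subinterval_real) (use assms in auto)
      from has_integral_shift_real_ivl[OF integrable_integral[OF this], of s]
      show ?thesis by (simp add: integral_unique add.commute)
    qed
    ultimately show "(weak_integral (s + t) f - weak_integral s f) \<bullet> v
        = integral {0..t} (\<lambda>r. f (s + r) \<bullet> v)"
      by (simp add: inner_diff_left inner_weak_integral[OF f] inner_weak_integral[OF s])
  qed
qed

section \<open>Strongly continuous semigroups\<close>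

locale strongly_continuous_semigroup =
  fixes S :: "real \<Rightarrow> 'a::{real_inner,complete_space} \<Rightarrow> 'a"
  assumes C0_semigroup: "C0_semigroup S"
begin

lemma bounded_linear: "0 \<le> t \<Longrightarrow> bounded_linear (S t)"
  and at_0: "S 0 x = x"
  and semigroup: "0 \<le> s \<Longrightarrow> 0 \<le> t \<Longrightarrow> S (s + t) x = S s (S t x)"
  and tendsto_at_0: "((\<lambda>t. S t x) \<longlongrightarrow> x) (at_right 0)"
  using C0_semigroup by (auto simp: C0_semigroup_def)

lemma add: "0 \<le> t \<Longrightarrow> S t (x + y) = S t x + S t y"
  and diff: "0 \<le> t \<Longrightarrow> S t (x - y) = S t x - S t y"
  and scaleR: "0 \<le> t \<Longrightarrow> S t (c *\<^sub>R x) = c *\<^sub>R S t x"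
  and zero: "0 \<le> t \<Longrightarrow> S t 0 = 0"
  using bounded_linear by (auto simp: linear_simps)

text \<open>Otherwise there are times \<open>\<tau> n\<close> tending to 0 at which the bound n
  fails. Yet each orbit converges along \<open>\<tau>\<close>, so it is bounded there, which
  contradicts uniform boundedness.\<close>

lemma bounded_near_0:
  obtains d M where "0 < d" "0 \<le> M" "\<And>t x. t \<in> {0..d} \<Longrightarrow> norm (S t x) \<le> M * norm x"
proof -
  have "\<exists>d>0. \<exists>M\<ge>0. \<forall>t\<in>{0..d}. \<forall>x. norm (S t x) \<le> M * norm x"
  proof (rule ccontr)
    assume unb: "\<not> ?thesis"
    have "\<exists>t. t \<in> {0..inverse (real (Suc n))} \<and> (\<exists>x. \<not> norm (S t x) \<le> real n * norm x)" for n
    proof -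
      have "\<not> (\<forall>t\<in>{0..inverse (real (Suc n))}. \<forall>x. norm (S t x) \<le> real n * norm x)"
        using unb by (metis inverse_positive_iff_positive of_nat_0_less_iff of_nat_0_le_iff zero_less_Suc)
      then show ?thesis by blast
    qed
    then obtain \<tau> where \<tau>: "\<And>n. \<tau> n \<in> {0..inverse (real (Suc n))}"
      and big: "\<And>n. \<exists>x. \<not> norm (S (\<tau> n) x) \<le> real n * norm x"
      by metis
    have "\<tau> \<longlonglongrightarrow> 0"
      by (rule tendsto_sandwich[OF _ _ tendsto_const LIMSEQ_inverse_real_of_nat]) (use \<tau> in auto)
    have "\<exists>B. \<forall>n\<in>UNIV. norm (S (\<tau> n) x) \<le> B" for x
    proof -
      have "(\<lambda>n. S (\<tau> n) x) \<longlonglongrightarrow> x"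
      proof (rule tendstoI)
        fix e :: real assume "0 < e"
        then have "eventually (\<lambda>t. dist (S t x) x < e) (at_right 0)"
          using tendstoD[OF tendsto_at_0] by blast
        then obtain b where b: "0 < b" "\<And>t. 0 < t \<Longrightarrow> t < b \<Longrightarrow> dist (S t x) x < e"
          unfolding eventually_at_right_field by blast
        have "eventually (\<lambda>n. \<tau> n < b) sequentially"
          using \<open>\<tau> \<longlonglongrightarrow> 0\<close> \<open>0 < b\<close> by (rule order_tendstoD)
        then show "eventually (\<lambda>n. dist (S (\<tau> n) x) x < e) sequentially"
        proof (rule eventually_mono)
          \<comment> \<open>The one-sided limit says nothing at time 0, a value that
            \<open>\<tau> n\<close> may take; there \<open>S 0\<close> is the identity.\<close>
          fix n assume "\<tau> n < b"
          then show "dist (S (\<tau> n) x) x < e"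
            using \<tau>[of n] b \<open>0 < e\<close> at_0 by (cases "\<tau> n = 0") auto
        qed
      qed
      then have "Bseq (\<lambda>n. S (\<tau> n) x)" by (intro convergent_imp_Bseq convergentI)
      then show ?thesis by (auto simp: Bseq_def)
    qed
    then obtain B where B: "0 \<le> B" "\<And>n x. n \<in> UNIV \<Longrightarrow> norm (S (\<tau> n) x) \<le> B * norm x"
      by (rule uniform_boundedness[rotated]) (use \<tau> in \<open>auto intro: bounded_linear\<close>)
    obtain n where "B \<le> real n" using real_arch_simple by blast
    then have "norm (S (\<tau> n) x) \<le> real n * norm x" for x
      using B(2)[of n x] mult_right_mono[of B "real n" "norm x"] by simp
    then show False using big by blast
  qed
  then show ?thesis using that by blast
qed

text \<open>Induction over multiples of \<open>d\<close>, splitting off one factor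
  \<open>S d\<close> at a time.\<close>

lemma locally_bounded:
  obtains M where "0 \<le> M" "\<And>t x. t \<in> {0..b} \<Longrightarrow> norm (S t x) \<le> M * norm x"
proof -
  obtain d K where "0 < d" "0 \<le> K" and K: "\<And>t x. t \<in> {0..d} \<Longrightarrow> norm (S t x) \<le> K * norm x"
    using bounded_near_0 by blast
  have "\<exists>M\<ge>0. \<forall>t\<in>{0..real n * d}. \<forall>x. norm (S t x) \<le> M * norm x" for n
  proof (induction n)
    case 0
    show ?case by (rule exI[of _ 1]) (auto simp: at_0)
  next
    case (Suc n)
    then obtain M where "0 \<le> M" and M: "\<And>t x. t \<in> {0..real n * d} \<Longrightarrow> norm (S t x) \<le> M * norm x"
      by blast
    have "norm (S t x) \<le> max K (K * M) * norm x" if t: "t \<in> {0..real (Suc n) * d}" for t x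
    proof (cases "t \<le> d")
      case True
      then have "norm (S t x) \<le> K * norm x" using K t by simp
      then show ?thesis
        using mult_right_mono[of K "max K (K * M)" "norm x"] by simp
    next
      case False
      then have "S t x = S d (S (t - d) x)"
        using semigroup[of d "t - d" x] \<open>0 < d\<close> by simp
      also have "norm \<dots> \<le> K * norm (S (t - d) x)" using K \<open>0 < d\<close> by simp
      also have "\<dots> \<le> K * (M * norm x)"
        using False t \<open>0 \<le> K\<close> by (intro mult_left_mono M) (auto simp: algebra_simps)
      finally show ?thesis
        using mult_right_mono[of "K * M" "max K (K * M)" "norm x"] by (simp add: mult.assoc)
    qed
    moreover have "0 \<le> max K (K * M)" using \<open>0 \<le> K\<close> by simp
    ultimately show ?case by blast
  qed
  moreover obtain n where "b / d \<le> real n" using real_arch_simple by blast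
  then have "b \<le> real n * d" using \<open>0 < d\<close> by (simp add: field_simps)
  ultimately show ?thesis using that by (metis atLeastAtMost_iff order.trans)
qed

text \<open>For u <= v the difference of the orbit is \<open>S u\<close> applied to
  \<open>S (v - u) x - x\<close>. With \<open>S u\<close> locally bounded, right continuity at 0
  therefore yields continuity from both sides everywhere.\<close>

lemma continuous: "continuous_on {0..b} (\<lambda>t. S t x)"
proof (cases "0 \<le> b")
  case True
  obtain M where "0 \<le> M" and M: "\<And>t x. t \<in> {0..b} \<Longrightarrow> norm (S t x) \<le> M * norm x"
    using locally_bounded by blast
  show ?thesis
    unfolding continuous_on_iff
  proof (intro ballI allI impI)
    fix t e :: real assume t: "t \<in> {0..b}" and "0 < e"
    define e' where "e' = e / (M + 1)"
    have "0 < e'" using \<open>0 < e\<close> \<open>0 \<le> M\<close> by (simp add: e'_def)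
    then have "eventually (\<lambda>r. dist (S r x) x < e') (at_right 0)"
      by (rule tendstoD[OF tendsto_at_0])
    then obtain d where "0 < d" and d: "\<And>r. 0 < r \<Longrightarrow> r < d \<Longrightarrow> dist (S r x) x < e'"
      unfolding eventually_at_right_field by blast
    have step: "dist (S v x) (S u x) < e" if "u \<in> {0..b}" "v \<in> {0..b}" "u \<le> v" "v - u < d" for u v
    proof -
      have "S v x - S u x = S u (S (v - u) x - x)"
        using semigroup[of u "v - u" x] that by (simp add: diff)
      then have "norm (S v x - S u x) \<le> M * norm (S (v - u) x - x)" using M that by metis
      also have "\<dots> \<le> M * e'"
      proof (rule mult_left_mono[OF _ \<open>0 \<le> M\<close>])
        show "norm (S (v - u) x - x) \<le> e'"
        proof (cases "u = v")
          case False
          then show ?thesis using d[of "v - u"] that by (simp add: dist_norm)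
        qed (use \<open>0 < e'\<close> in \<open>simp add: at_0\<close>)
      qed
      also have "\<dots> < (M + 1) * e'" using \<open>0 < e'\<close> by simp
      also have "\<dots> = e" using \<open>0 \<le> M\<close> by (simp add: e'_def)
      finally show ?thesis by (simp add: dist_norm)
    qed
    show "\<exists>d>0. \<forall>u\<in>{0..b}. dist u t < d \<longrightarrow> dist (S u x) (S t x) < e"
    proof (intro exI conjI ballI impI)
      fix u assume "u \<in> {0..b}" "dist u t < d"
      then show "dist (S u x) (S t x) < e"
        using step[of u t] step[of t u] t by (cases "u \<le> t") (auto simp: dist_real_def dist_commute)
    qed fact
  qed
qed simp

text \<open>The local bound controls the change of the vector, strong continuity the change of time.
  Compactness later turns this into the uniform modulus of the telescoping argument.\<close>

lemma jointly_continuous: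
  assumes g: "continuous_on A g"
  shows "continuous_on ({0..b} \<times> A) (\<lambda>p. S (fst p) (g (snd p)))"
  unfolding continuous_on_def
proof
  fix q assume q: "q \<in> {0..b} \<times> A"
  obtain M where "0 \<le> M" and M: "\<And>t x. t \<in> {0..b} \<Longrightarrow> norm (S t x) \<le> M * norm x"
    using locally_bounded by blast
  let ?F = "at q within {0..b} \<times> A"
  let ?y = "g (snd q)"
  have "((\<lambda>p. S (fst p) ?y) \<longlongrightarrow> S (fst q) ?y) ?F"
    using continuous_on_compose2[OF continuous[of b ?y] continuous_on_fst[OF continuous_on_id], of "{0..b} \<times> A"] q
    by (auto simp: continuous_on_def)
  moreover have "((\<lambda>p. g (snd p)) \<longlongrightarrow> ?y) ?F"
    using continuous_on_compose2[OF g continuous_on_snd[OF continuous_on_id], of "{0..b} \<times> A"] q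
    by (auto simp: continuous_on_def)
  ultimately have lim: "((\<lambda>p. M * dist (g (snd p)) ?y + dist (S (fst p) ?y) (S (fst q) ?y)) \<longlongrightarrow>
      M * 0 + 0) ?F"
    by (intro tendsto_add tendsto_mult tendsto_const) (simp_all add: tendsto_dist_iff[symmetric])
  have le: "dist (S (fst p) (g (snd p))) (S (fst q) ?y)
      \<le> M * dist (g (snd p)) ?y + dist (S (fst p) ?y) (S (fst q) ?y)" if "p \<in> {0..b} \<times> A" for p
  proof -
    have "dist (S (fst p) (g (snd p))) (S (fst p) ?y) \<le> M * dist (g (snd p)) ?y"
      using M[of "fst p" "g (snd p) - ?y"] that by (auto simp: dist_norm diff)
    then show ?thesis
      using dist_triangle[of "S (fst p) (g (snd p))" "S (fst q) ?y" "S (fst p) ?y"] by simp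
  qed
  have "((\<lambda>p. dist (S (fst p) (g (snd p))) (S (fst q) ?y)) \<longlongrightarrow> 0) ?F"
    by (rule tendsto_sandwich[OF _ _ tendsto_const lim[simplified]])
      (auto simp: eventually_at_filter intro!: always_eventually le)
  then show "((\<lambda>p. S (fst p) (g (snd p))) \<longlongrightarrow> S (fst q) ?y) ?F"
    by (simp add: tendsto_dist_iff[of _ "S (fst q) ?y"])
qed

abbreviation I :: "real \<Rightarrow> 'a \<Rightarrow> 'a" where "I t x \<equiv> weak_integral t (\<lambda>r. S r x)"

lemma weakly_continuous: "weakly_continuous t (\<lambda>r. S r x)"
  by (rule continuous_imp_weakly_continuous[OF continuous])

lemma apply_I:
  assumes "0 \<le> s" "0 \<le> t"
  shows "S s (I t x) = I (s + t) x - I s x"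
proof -
  have "S s (I t x) = weak_integral t (\<lambda>r. S s (S r x))"
    by (rule bounded_linear_weak_integral(2)[OF weakly_continuous bounded_linear[OF \<open>0 \<le> s\<close>]])
  also have "\<dots> = weak_integral t (\<lambda>r. S (s + r) x)"
    by (rule weak_integral_cong) (simp add: semigroup \<open>0 \<le> s\<close>)
  also have "\<dots> = I (s + t) x - I s x"
    by (rule weak_integral_shift(2)[OF weakly_continuous assms])
  finally show ?thesis .
qed

text \<open>The right-hand side is that of \<open>apply_I\<close>: the semigroup commutes with its
  integrals.\<close>

lemma I_apply:
  assumes "0 \<le> s" "0 \<le> t"
  shows "I t (S s x) = I (s + t) x - I s x"
proof -
  have "I t (S s x) = weak_integral t (\<lambda>r. S (s + r) x)"
    by (rule weak_integral_cong) (simp add: semigroup[symmetric] \<open>0 \<le> s\<close> add.commute)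
  also have "\<dots> = I (s + t) x - I s x"
    by (rule weak_integral_shift(2)[OF weakly_continuous assms])
  finally show ?thesis .
qed

lemma I_diff: "I t (x - y) = I t x - I t y"
  unfolding weak_integral_diff(2)[OF weakly_continuous weakly_continuous, symmetric]
  by (rule weak_integral_cong) (simp add: diff)

text \<open>This amounts to density of the domain of the generator, since the integrals
  \<open>I h x\<close> belong to it.\<close>

lemma average_tendsto: "((\<lambda>h. (1 / h) *\<^sub>R I h x) \<longlongrightarrow> x) (at_right 0)"
proof (rule tendstoI)
  fix e :: real assume "0 < e"
  then have "eventually (\<lambda>r. dist (S r x) x < e / 2) (at_right 0)"
    by (intro tendstoD[OF tendsto_at_0]) simp
  then obtain d where "0 < d" and d: "\<And>r. 0 < r \<Longrightarrow> r < d \<Longrightarrow> dist (S r x) x < e / 2"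
    unfolding eventually_at_right_field by blast
  have "dist ((1 / h) *\<^sub>R I h x) x < e" if "0 < h" "h < d" for h
  proof -
    have "norm (S r x - x) \<le> e / 2" if "r \<in> {0..h}" for r
      using d[of r] that \<open>h < d\<close> \<open>0 < e\<close> by (cases "r = 0") (auto simp: at_0 dist_norm less_imp_le)
    then have "norm (I h x - h *\<^sub>R x) \<le> h * (e / 2)"
      using \<open>0 < h\<close> by (intro norm_weak_integral_diff_le weakly_continuous) auto
    moreover have "(1 / h) *\<^sub>R I h x - x = (1 / h) *\<^sub>R (I h x - h *\<^sub>R x)"
      using \<open>0 < h\<close> by (simp add: scaleR_diff_right)
    ultimately have "dist ((1 / h) *\<^sub>R I h x) x \<le> e / 2"
      using \<open>0 < h\<close> by (simp only: dist_norm norm_scaleR) (simp add: field_simps)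
    then show ?thesis using \<open>0 < e\<close> by simp
  qed
  then show "eventually (\<lambda>h. dist ((1 / h) *\<^sub>R I h x) x < e) (at_right 0)"
    unfolding eventually_at_right_field using \<open>0 < d\<close> by blast
qed

text \<open>The vectors \<open>\<integral>\<^sub>0\<^sup>h S\<^sub>r\<^sup>* w dr\<close> are points of continuity of the adjoint semigroup, and a vector
  orthogonal to all of them is orthogonal to every \<open>w\<close>.\<close>

theorem C0_semigroup_adjoint: "C0_semigroup (\<lambda>t. adjoint (S t))"
proof -
  let ?T = "\<lambda>t. adjoint (S t)"
  have T: "x \<bullet> ?T t y = S t x \<bullet> y" if "0 \<le> t" for t x y
    by (rule inner_adjoint[OF bounded_linear[OF that]])
  obtain M where "0 \<le> M" and M: "\<And>t x. t \<in> {0..1} \<Longrightarrow> norm (S t x) \<le> M * norm x"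
    using locally_bounded[of 1] by blast
  have eqI: "a = b" if "\<And>x. x \<bullet> a = x \<bullet> b" for a b :: 'a
    using that vector_eq_ldot by blast
  have T_linear: "bounded_linear (?T t)" if "0 \<le> t" for t
  proof -
    obtain K where "0 < K" and K: "\<And>x. norm (S t x) \<le> norm x * K"
      using bounded_linear.pos_bounded[OF bounded_linear[OF \<open>0 \<le> t\<close>]] by blast
    show ?thesis
    proof (rule bounded_linear_intro)
      show "?T t (x + y) = ?T t x + ?T t y" for x y
        by (rule eqI) (simp add: T[OF that] inner_add_right)
      show "?T t (c *\<^sub>R x) = c *\<^sub>R ?T t x" for c x
        by (rule eqI) (simp add: T[OF that])
      show "norm (?T t x) \<le> norm x * K" for x
        using norm_adjoint_le[OF bounded_linear[OF that], of K x] K \<open>0 < K\<close>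
        by (simp add: mult.commute)
    qed
  qed
  have T_bound: "norm (?T t x) \<le> M * norm x" if "t \<in> {0..1}" for t x
    using that by (intro norm_adjoint_le bounded_linear M \<open>0 \<le> M\<close>) auto
  define X where "X = {w. ((\<lambda>t. ?T t w) \<longlongrightarrow> w) (at_right 0)}"
  have near0: "eventually (\<lambda>t. t \<in> {0<..<1}) (at_right (0::real))"
    by (rule eventually_at_right_real) simp
  have "subspace X"
    unfolding subspace_def
  proof (intro conjI ballI allI)
    have "eventually (\<lambda>t. ?T t 0 = 0) (at_right 0)"
      using near0 by (rule eventually_mono) (auto simp: linear_simps(3)[OF T_linear])
    then show "0 \<in> X" unfolding X_def by (simp add: tendsto_eventually)
  next
    fix x y assume xy: "x \<in> X" "y \<in> X"
    have "eventually (\<lambda>t. ?T t x + ?T t y = ?T t (x + y)) (at_right 0)"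
      using near0 by (rule eventually_mono) (auto simp: linear_simps[OF T_linear])
    moreover have "((\<lambda>t. ?T t x + ?T t y) \<longlongrightarrow> x + y) (at_right 0)"
      using xy by (intro tendsto_add) (auto simp: X_def)
    ultimately show "x + y \<in> X" by (auto simp: X_def intro: Lim_transform_eventually)
  next
    fix c x assume x: "x \<in> X"
    have "eventually (\<lambda>t. c *\<^sub>R ?T t x = ?T t (c *\<^sub>R x)) (at_right 0)"
      using near0 by (rule eventually_mono) (auto simp: linear_simps[OF T_linear])
    moreover have "((\<lambda>t. c *\<^sub>R ?T t x) \<longlongrightarrow> c *\<^sub>R x) (at_right 0)"
      using x by (intro tendsto_scaleR tendsto_const) (auto simp: X_def)
    ultimately show "c *\<^sub>R x \<in> X" by (auto simp: X_def intro: Lim_transform_eventually)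
  qed
  moreover have "closed X"
  proof -
    have "closure X \<subseteq> X"
    proof
      fix w assume w: "w \<in> closure X"
      have "((\<lambda>t. ?T t w) \<longlongrightarrow> w) (at_right 0)"
      proof (rule tendstoI)
        fix e :: real assume "0 < e"
        \<comment> \<open>Three errors are added, \<open>M * e'\<close> from moving
          \<open>?T t w\<close> to \<open>?T t v\<close> and \<open>e'\<close> twice; hence M +
          2.\<close>
        define e' where "e' = e / (M + 2)"
        have "0 < e'" using \<open>0 < e\<close> \<open>0 \<le> M\<close> by (simp add: e'_def)
        then obtain v where v: "v \<in> X" "dist v w < e'" using w closure_approachable by blast
        have "eventually (\<lambda>t. dist (?T t v) v < e') (at_right 0)"
          using v \<open>0 < e'\<close> tendstoD unfolding X_def by blast
        with near0 show "eventually (\<lambda>t. dist (?T t w) w < e) (at_right 0)"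
        proof eventually_elim
          case (elim t)
          have "norm (?T t w - ?T t v) \<le> M * norm (w - v)"
            using T_bound[of t "w - v"] elim by (simp add: linear_simps[OF T_linear])
          also have "\<dots> \<le> M * e'"
            using v \<open>0 \<le> M\<close> by (intro mult_left_mono) (auto simp: dist_norm norm_minus_commute)
          finally have "dist (?T t w) (?T t v) \<le> M * e'" by (simp add: dist_norm)
          moreover have "dist (?T t w) w \<le> dist (?T t w) (?T t v) + dist (?T t v) v + dist v w"
            by (metis dist_triangle add.commute add_left_mono order.trans add.assoc)
          ultimately have "dist (?T t w) w < M * e' + e' + e'" using elim v by linarith
          also have "\<dots> = (M + 2) * e'" by (simp add: algebra_simps)
          also have "\<dots> = e" using \<open>0 \<le> M\<close> by (simp add: e'_def)
          finally show ?case .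
        qed
      qed
      then show "w \<in> X" by (simp add: X_def)
    qed
    then show ?thesis by (simp add: closure_subset_eq)
  qed
  ultimately have X: "closed_subspace X" by (simp add: closed_subspace_def)
  \<comment> \<open>Weak continuity of adjoint orbits costs nothing: the pairing with
    \<open>v\<close> is that of the continuous orbit of \<open>v\<close> with
    \<open>w\<close>.\<close>
  have T_wc: "weakly_continuous b (\<lambda>r. ?T r w)" for b w
  proof -
    obtain K where "0 \<le> K" and K: "\<And>t x. t \<in> {0..b} \<Longrightarrow> norm (S t x) \<le> K * norm x"
      using locally_bounded[of b] by blast
    have "norm (?T t w) \<le> K * norm w" if "t \<in> {0..b}" for t
      using that by (intro norm_adjoint_le bounded_linear K \<open>0 \<le> K\<close>) auto
    moreover have "continuous_on {0..b} (\<lambda>r. ?T r w \<bullet> v)" for v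
    proof -
      have "continuous_on {0..b} (\<lambda>r. S r v \<bullet> w)" by (intro continuous_intros continuous)
      then show ?thesis
        by (rule continuous_on_cong[THEN iffD1, rotated 2]) (auto simp: inner_commute T)
    qed
    ultimately show ?thesis unfolding weakly_continuous_def by blast
  qed
  have X_dense: "weak_integral h (\<lambda>r. ?T r w) \<in> X" if "0 < h" for h w
  proof -
    let ?J = "\<lambda>t. weak_integral t (\<lambda>r. ?T r w)"
    \<comment> \<open>The integral over [h, h + t] with t < 1 involves times up to h + 1.\<close>
    obtain K where "0 \<le> K" and K: "\<And>t x. t \<in> {0..h+1} \<Longrightarrow> norm (S t x) \<le> K * norm x"
      using locally_bounded[of "h+1"] by blast
    have bd: "norm (?T t w) \<le> K * norm w" if "t \<in> {0..h+1}" for t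
      using that by (intro norm_adjoint_le bounded_linear K \<open>0 \<le> K\<close>) auto
    have T_add: "?T t (?T r w) = ?T (r + t) w" if "0 \<le> t" "0 \<le> r" for r t
      by (rule eqI) (simp add: T semigroup that)
    have T_J: "?T t (?J a) = ?J (t + a) - ?J t" if "0 \<le> t" "0 \<le> a" for t a
    proof -
      have "?T t (?J a) = weak_integral a (\<lambda>r. ?T t (?T r w))"
        by (rule bounded_linear_weak_integral(2)[OF T_wc T_linear[OF that(1)]])
      also have "\<dots> = weak_integral a (\<lambda>r. ?T (t + r) w)"
        by (rule weak_integral_cong) (simp add: T_add that add.commute)
      also have "\<dots> = ?J (t + a) - ?J t"
        by (rule weak_integral_shift(2)[OF T_wc that])
      finally show ?thesis .
    qed
    have "dist (?T t (?J h)) (?J h) \<le> 2 * t * (K * norm w)" if t: "t \<in> {0<..<1}" for t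
    proof -
      have small: "norm (?J t) \<le> t * (K * norm w)"
        using t \<open>0 < h\<close> by (intro norm_weak_integral_le T_wc bd) auto
      have "norm (weak_integral t (\<lambda>r. ?T (h + r) w)) \<le> t * (K * norm w)"
        using t \<open>0 < h\<close> by (intro norm_weak_integral_le weak_integral_shift(1) T_wc bd) auto
      then have "norm (?J (h + t) - ?J h) \<le> t * (K * norm w)"
        using t \<open>0 < h\<close> by (subst (asm) weak_integral_shift(2)[OF T_wc]) auto
      moreover have "?T t (?J h) - ?J h = (?J (h + t) - ?J h) - ?J t"
        using T_J[of t h] t \<open>0 < h\<close> by (simp add: add.commute)
      ultimately show ?thesis
        using small norm_triangle_ineq4[of "?J (h + t) - ?J h" "?J t"] by (simp only: dist_norm)
    qed
    then have "eventually (\<lambda>t. dist (?T t (?J h)) (?J h) \<le> 2 * t * (K * norm w)) (at_right 0)"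
      using near0 by (rule eventually_mono[rotated])
    moreover have "((\<lambda>t. 2 * t * (K * norm w)) \<longlongrightarrow> 2 * 0 * (K * norm w)) (at_right 0)"
      by (intro tendsto_intros)
    then have "((\<lambda>t. 2 * t * (K * norm w)) \<longlongrightarrow> 0) (at_right 0)" by simp
    ultimately have "((\<lambda>t. dist (?T t (?J h)) (?J h)) \<longlongrightarrow> 0) (at_right 0)"
      by (rule tendsto_sandwich[OF _ _ tendsto_const, rotated 1]) simp
    then show ?thesis unfolding X_def by (simp add: tendsto_dist_iff[of _ "?J h"])
  qed
  have "w \<in> X" for w
  proof -
    \<comment> \<open>The part of \<open>w\<close> orthogonal to \<open>X\<close>. It is orthogonal
      to all integrals of adjoint orbits, so its own orbit has vanishing integrals, and their
      averages converge to \<open>z\<close>.\<close>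
    define z where "z = w - proj X w"
    have z: "z \<bullet> x = 0" if "x \<in> X" for x
      using inner_proj[OF X that, of w] by (simp add: z_def inner_diff inner_commute)
    have "I h z = 0" if "0 < h" for h
    proof -
      have "I h z \<bullet> v = 0" for v
      proof -
        have "I h z \<bullet> v = integral {0..h} (\<lambda>r. S r z \<bullet> v)"
          by (rule inner_weak_integral[OF weakly_continuous])
        also have "\<dots> = integral {0..h} (\<lambda>r. ?T r v \<bullet> z)"
          by (rule integral_cong) (simp add: T inner_commute[of _ z])
        also have "\<dots> = weak_integral h (\<lambda>r. ?T r v) \<bullet> z"
          by (rule inner_weak_integral[OF T_wc, symmetric])
        also have "\<dots> = 0" using z[OF X_dense[OF that]] by (simp add: inner_commute)
        finally show ?thesis .
      qed
      then show ?thesis by (metis inner_eq_zero_iff)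
    qed
    then have "eventually (\<lambda>h. (1 / h) *\<^sub>R I h z = 0) (at_right 0)"
      using near0 by (auto elim!: eventually_mono)
    from average_tendsto[of z] tendsto_eventually[OF this] have "z = 0"
      by (rule tendsto_unique[OF trivial_limit_at_right_real])
    then show ?thesis using proj_in[OF X, of w] by (simp add: z_def)
  qed
  moreover have "?T 0 x = x" for x by (rule eqI) (simp add: T at_0)
  moreover have "?T (s + t) x = ?T s (?T t x)" if "0 \<le> s" "0 \<le> t" for s t x
    by (rule eqI) (simp add: T that semigroup[of t s, symmetric] add.commute)
  ultimately show ?thesis
    unfolding C0_semigroup_def using T_linear by (simp add: X_def)
qed

end

section \<open>Cocycles of a semigroup with a left inverse semigroup\<close>

text \<open>Being killed by \<open>R t\<close> stands in for membership in G_{0,t}, so that the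
  notion also makes sense for the adjoint pair. Continuity of the pairings supplies measurability on
  the real side.\<close>

definition cocycles :: "(real \<Rightarrow> 'a::real_inner \<Rightarrow> 'a) \<Rightarrow> (real \<Rightarrow> 'a \<Rightarrow> 'a) \<Rightarrow> (real \<Rightarrow> 'a) set" where
  "cocycles S R = {x. (\<forall>t>0. R t (x t) = 0) \<and> (\<forall>v. continuous_on {0<..} (\<lambda>t. x t \<bullet> v)) \<and>
     (\<forall>s>0. \<forall>t>0. x (s + t) = x s + S s (x t))}"

text \<open>Only one-sided inverses: \<open>S t\<close> after \<open>R t\<close> is a projection
  along the kernel of \<open>R t\<close>. Adjoints with exchanged roles form such a pair again, so
  results proved here serve both kinds of addits.\<close>

locale left_inverse_semigroups = S: strongly_continuous_semigroup S + R: strongly_continuous_semigroup R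
  for S R :: "real \<Rightarrow> 'a::{real_inner,complete_space} \<Rightarrow> 'a" +
  assumes left_inverse: "0 \<le> t \<Longrightarrow> R t (S t x) = x"
begin

text \<open>For r <= t one has R_t S_r = R_{t-r}, and reversing [0,t] does not change the
  integral.\<close>

lemma R_S_I:
  assumes "0 \<le> t"
  shows "R t (S.I t u) = R.I t u"
proof -
  have "R t (S.I t u) = weak_integral t (\<lambda>r. R t (S r u))"
    by (rule bounded_linear_weak_integral(2)[OF S.weakly_continuous R.bounded_linear[OF assms]])
  also have "\<dots> = weak_integral t (\<lambda>r. R (t - r) u)"
  proof (rule weak_integral_cong)
    fix r assume "r \<in> {0..t}"
    then show "R t (S r u) = R (t - r) u"
      using R.semigroup[of "t - r" r "S r u"] left_inverse by simp
  qed
  also have "\<dots> = R.I t u"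
    by (rule weak_integral_reverse(2)[OF R.weakly_continuous assms])
  finally show ?thesis .
qed

text \<open>For \<open>w = \<integral>\<^sub>0\<^sup>h R\<^sub>r z dr\<close>, a vector in the domain of the generator \<open>B\<close> of \<open>R\<close>, one has
  \<open>R\<^sub>h z - z = B w\<close>, and the cocycle is \<open>S\<^sub>t w - w + \<integral>\<^sub>0\<^sup>t S\<^sub>r B w dr\<close>.\<close>

definition generator_cocycle :: "real \<Rightarrow> 'a \<Rightarrow> real \<Rightarrow> 'a" where
  "generator_cocycle h z t = S t (R.I h z) - R.I h z + S.I t (R h z - z)"

text \<open>The integrated form of the generator equation: the increment of the orbit of w is the
  integral of the orbit of B w.\<close>

lemma R_I_minus:
  assumes "0 \<le> h" "0 \<le> t"
  shows "R t (R.I h z) - R.I h z = R.I t (R h z - z)"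
  using assms by (simp add: R.I_diff R.apply_I R.I_apply add.commute)

text \<open>Coboundary and integral are additive separately; their images under \<open>R t\<close>
  are opposite by \<open>R_I_minus\<close>.\<close>

lemma generator_cocycle_in_cocycles:
  assumes "0 \<le> h"
  shows "generator_cocycle h z \<in> cocycles S R"
  unfolding cocycles_def
proof (intro CollectI conjI allI impI)
  let ?w = "R.I h z" and ?u = "R h z - z"
  show "R t (generator_cocycle h z t) = 0" if "0 < t" for t
  proof -
    have "R t (generator_cocycle h z t) = ?w - R t ?w + R.I t ?u"
      using that by (simp add: generator_cocycle_def R.add R.diff left_inverse R_S_I)
    then show ?thesis using R_I_minus[of h t z] assms that by (simp add: algebra_simps)
  qed
  show "generator_cocycle h z (s + t) = generator_cocycle h z s + S s (generator_cocycle h z t)"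
    if "0 < s" "0 < t" for s t
    using that by (simp add: generator_cocycle_def S.add S.diff S.apply_I S.semigroup)
  fix v
  show "continuous_on {0<..} (\<lambda>t. generator_cocycle h z t \<bullet> v)"
  \<comment> \<open>Continuity is local, so it suffices to work on the compact interval [0, t + 1],
    which has t in its interior.\<close>
  proof (rule continuous_at_imp_continuous_on, rule ballI)
    fix t :: real assume t: "t \<in> {0<..}"
    have "continuous_on {0..t+1} (\<lambda>t. integral {0..t} (\<lambda>r. S r ?u \<bullet> v))"
      by (intro indefinite_integral_continuous_1 integrable_inner S.weakly_continuous)
    then have "continuous_on {0..t+1} (\<lambda>t. generator_cocycle h z t \<bullet> v)"
      unfolding generator_cocycle_def inner_add_left inner_diff_left
        inner_weak_integral[OF S.weakly_continuous]
      by (intro continuous_intros S.continuous)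
    moreover have "t \<in> interior {0..t+1}" using t by simp
    ultimately show "isCont (\<lambda>t. generator_cocycle h z t \<bullet> v) t"
      by (rule continuous_on_interior)
  qed
qed

definition increments :: "real \<Rightarrow> 'a set" where
  "increments s = {S s1 (x (s2 - s1)) | x s1 s2. 0 \<le> s1 \<and> s1 < s2 \<and> s2 \<le> s \<and> x \<in> cocycles S R}"

text \<open>To first order in \<open>\<delta>\<close>, the cocycle attached to \<open>w\<close> is \<open>S\<^sub>\<delta> R\<^sub>\<delta> w - w\<close>.\<close>

lemma generator_cocycle_approx:
  assumes "0 \<le> h" "0 \<le> \<delta>"
    and e: "\<And>r. r \<in> {0..\<delta>} \<Longrightarrow> norm (S r (R h z - z) - S \<delta> (R r (R h z - z))) \<le> e"
  shows "norm (R.I h z - S \<delta> (R \<delta> (R.I h z)) + generator_cocycle h z \<delta>) \<le> \<delta> * e"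
proof -
  let ?w = "R.I h z" and ?u = "R h z - z"
  note wc = bounded_linear_weak_integral[OF R.weakly_continuous S.bounded_linear[OF \<open>0 \<le> \<delta>\<close>]]
  have "?w - S \<delta> (R \<delta> ?w) + generator_cocycle h z \<delta> = S.I \<delta> ?u - S \<delta> (R \<delta> ?w - ?w)"
    using \<open>0 \<le> \<delta>\<close> by (simp add: generator_cocycle_def S.diff)
  also have "\<dots> = S.I \<delta> ?u - S \<delta> (R.I \<delta> ?u)"
    using assms by (simp only: R_I_minus)
  also have "\<dots> = weak_integral \<delta> (\<lambda>r. S r ?u - S \<delta> (R r ?u))"
    by (simp only: wc weak_integral_diff(2)[OF S.weakly_continuous wc(1)])
  also have "norm \<dots> \<le> \<delta> * e"
    by (intro norm_weak_integral_le weak_integral_diff(1)[OF S.weakly_continuous wc(1)] assms)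
  finally show ?thesis .
qed

text \<open>Passing from time a to a + \<delta> changes the left side by \<open>S a\<close> applied
  to the one-step defect at \<open>R a ?w\<close>, so \<open>generator_cocycle_approx\<close> bounds
  every step and the errors merely add up.\<close>

lemma generator_domain_in_closure:
  assumes "0 < s" "0 \<le> h"
  shows "R.I h z - S s (R s (R.I h z)) \<in> closure (span (increments s))"
  unfolding closure_approachable
proof (intro allI impI)
  fix e :: real assume "0 < e"
  let ?w = "R.I h z" and ?u = "R h z - z"
  obtain M where "0 \<le> M" and M: "\<And>t x. t \<in> {0..s} \<Longrightarrow> norm (S t x) \<le> M * norm x"
    using S.locally_bounded by blast
  \<comment> \<open>Each of the n steps costs \<open>M * (\<delta> * e')\<close>, together
    \<open>M * s * e'\<close> because n \<delta> = s; adding 1 allows for M = 0.\<close>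
  define e' where "e' = e / (M * s + 1)"
  have "0 < M * s + 1" using \<open>0 \<le> M\<close> \<open>0 < s\<close> by (simp add: add_nonneg_pos)
  then have "0 < e'" using \<open>0 < e\<close> by (simp add: e'_def)
  have "uniformly_continuous_on ({0..s} \<times> {0..s}) (\<lambda>p. S (fst p) (R (snd p) ?u))"
    by (intro compact_uniformly_continuous S.jointly_continuous R.continuous compact_Times) auto
  then obtain d where "0 < d"
    and d: "\<And>p q. p \<in> {0..s} \<times> {0..s} \<Longrightarrow> q \<in> {0..s} \<times> {0..s} \<Longrightarrow> dist q p < d \<Longrightarrow>
      dist (S (fst q) (R (snd q) ?u)) (S (fst p) (R (snd p) ?u)) < e'"
    using \<open>0 < e'\<close> unfolding uniformly_continuous_on_def by meson
  obtain n :: nat where n: "s / d < real n" using reals_Archimedean2 by blast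
  then have "0 < n" using \<open>0 < s\<close> \<open>0 < d\<close> by (metis divide_pos_pos less_trans of_nat_0_less_iff)
  define \<delta> where "\<delta> = s / real n"
  have "0 < \<delta>" "\<delta> < d" "real n * \<delta> = s"
    using n \<open>0 < n\<close> \<open>0 < s\<close> \<open>0 < d\<close> by (auto simp: \<delta>_def field_simps)
  \<comment> \<open>Replacing \<open>z\<close> by \<open>R a z\<close> replaces \<open>?w\<close> by
    \<open>R a ?w\<close> and \<open>?u\<close> by \<open>R a ?u\<close>, so the modulus
    \<open>d\<close>, chosen for \<open>?u\<close> alone, works for every starting time a.\<close>
  have step: "norm (R.I h (R a z) - S \<delta> (R \<delta> (R.I h (R a z))) + generator_cocycle h (R a z) \<delta>) \<le> \<delta> * e'"
    if a: "0 \<le> a" "a + \<delta> \<le> s" for a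
  proof (rule generator_cocycle_approx[OF \<open>0 \<le> h\<close>])
    fix r assume r: "r \<in> {0..\<delta>}"
    have "R h (R a z) - R a z = R a ?u"
      using R.semigroup[of a h z] R.semigroup[of h a z] a \<open>0 \<le> h\<close> by (simp add: R.diff add.commute)
    moreover have "R r (R a ?u) = R (a + r) ?u"
      using R.semigroup[of r a ?u] a r by (simp add: add.commute)
    moreover have "dist (S r (R a ?u)) (S \<delta> (R (a + r) ?u)) < e'"
    proof -
      \<comment> \<open>Both terms of the integrand are values of one function on the square, at
        points whose coordinates differ by \<delta> - r and r, hence at distance at most
        \<delta>.\<close>
      have "dist (r, a) (\<delta>, a + r) = sqrt ((\<delta> - r)\<^sup>2 + r\<^sup>2)"
        by (simp add: dist_Pair_Pair dist_real_def power2_commute)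
      also have "\<dots> \<le> (\<delta> - r) + r" using r by (intro sqrt_sum_squares_le_sum) auto
      finally have "dist (r, a) (\<delta>, a + r) < d" using \<open>\<delta> < d\<close> by simp
      then show ?thesis using d[of "(\<delta>, a + r)" "(r, a)"] a r by auto
    qed
    ultimately show "norm (S r (R h (R a z) - R a z) - S \<delta> (R r (R h (R a z) - R a z))) \<le> e'"
      by (simp add: dist_norm)
  qed (use \<open>0 < \<delta>\<close> in simp)
  define x where "x k = generator_cocycle h (R (real k * \<delta>) z)" for k
  define y where "y m = (\<Sum>k<m. S (real k * \<delta>) (x k \<delta>))" for m :: nat
  have R_w: "R.I h (R a z) = R a ?w" if "0 \<le> a" for a
    using that \<open>0 \<le> h\<close> by (simp add: R.apply_I R.I_apply)
  \<comment> \<open>The sum has a plus sign because each cocycle value approximates the negative of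
    its telescoping term; the approximating vector is therefore \<open>- y n\<close>.\<close>
  have approx: "norm (?w - S (real m * \<delta>) (R (real m * \<delta>) ?w) + y m) \<le> real m * (M * (\<delta> * e'))"
    if "m \<le> n" for m
    using that
  proof (induction m)
    case 0
    show ?case by (simp add: y_def S.at_0 R.at_0)
  next
    case (Suc m)
    define a where "a = real m * \<delta>"
    have a0: "0 \<le> a" using \<open>0 < \<delta>\<close> by (simp add: a_def)
    have "real (Suc m) * \<delta> \<le> real n * \<delta>"
      using Suc.prems \<open>0 < \<delta>\<close> by (intro mult_right_mono) auto
    then have a_le: "a + \<delta> \<le> s" using \<open>real n * \<delta> = s\<close> by (simp add: a_def algebra_simps)
    have Suc_a: "real (Suc m) * \<delta> = a + \<delta>" by (simp add: a_def algebra_simps)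
    have "R (a + \<delta>) ?w = R \<delta> (R a ?w)"
      using R.semigroup[of \<delta> a ?w] a0 \<open>0 < \<delta>\<close> by (simp add: add.commute)
    then have diff: "(?w - S (a + \<delta>) (R (a + \<delta>) ?w) + y (Suc m)) - (?w - S a (R a ?w) + y m)
        = S a (R a ?w - S \<delta> (R \<delta> (R a ?w)) + x m \<delta>)"
      using a0 \<open>0 < \<delta>\<close> by (simp add: y_def a_def[symmetric] S.add S.diff S.semigroup)
    have "norm (R a ?w - S \<delta> (R \<delta> (R a ?w)) + x m \<delta>) \<le> \<delta> * e'"
      using step[OF a0 a_le] by (simp add: R_w[OF a0] x_def a_def[symmetric])
    then have "norm (S a (R a ?w - S \<delta> (R \<delta> (R a ?w)) + x m \<delta>)) \<le> M * (\<delta> * e')"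
      using a0 a_le \<open>0 < \<delta>\<close> \<open>0 \<le> M\<close> by (intro order.trans[OF M] mult_left_mono) auto
    then have "norm (?w - S (a + \<delta>) (R (a + \<delta>) ?w) + y (Suc m))
        \<le> norm (?w - S a (R a ?w) + y m) + M * (\<delta> * e')"
      by (rule order.trans[OF norm_triangle_sub[of "?w - S (a + \<delta>) (R (a + \<delta>) ?w) + y (Suc m)"
        "?w - S a (R a ?w) + y m", unfolded diff] add_left_mono])
    also have "\<dots> \<le> real m * (M * (\<delta> * e')) + M * (\<delta> * e')"
      using Suc by (simp add: a_def)
    finally show ?case unfolding Suc_a by (simp add: algebra_simps)
  qed
  have "y n \<in> span (increments s)"
    unfolding y_def
  proof (intro span_sum span_base)
    fix k assume "k \<in> {..<n}"
    then have "real (Suc k) * \<delta> \<le> real n * \<delta>" using \<open>0 < \<delta>\<close> by (intro mult_right_mono) auto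
    then have "real k * \<delta> + \<delta> \<le> s" using \<open>real n * \<delta> = s\<close> by (simp add: algebra_simps)
    moreover have "x k \<in> cocycles S R"
      unfolding x_def by (rule generator_cocycle_in_cocycles[OF \<open>0 \<le> h\<close>])
    moreover have "0 \<le> real k * \<delta>" using \<open>0 < \<delta>\<close> by simp
    ultimately show "S (real k * \<delta>) (x k \<delta>) \<in> increments s"
      unfolding increments_def using \<open>0 < \<delta>\<close>
      by (intro CollectI exI[of _ "x k"] exI[of _ "real k * \<delta>"] exI[of _ "real k * \<delta> + \<delta>"]) auto
  qed
  then have "- y n \<in> span (increments s)" by (rule span_neg)
  moreover have "dist (- y n) (?w - S s (R s ?w)) < e"
  proof -
    have "dist (- y n) (?w - S s (R s ?w)) = norm (?w - S s (R s ?w) + y n)"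
      by (metis dist_commute dist_norm diff_minus_eq_add)
    also have "\<dots> \<le> real n * (M * (\<delta> * e'))"
      using approx[OF order.refl] by (simp add: \<open>real n * \<delta> = s\<close>)
    also have "\<dots> = (M * s) * e'" using \<open>real n * \<delta> = s\<close> by (simp add: algebra_simps)
    also have "\<dots> < (M * s + 1) * e'" using \<open>0 < e'\<close> by simp
    also have "\<dots> = e" using \<open>0 < M * s + 1\<close> by (simp add: e'_def)
    finally show ?thesis .
  qed
  ultimately show "\<exists>y\<in>span (increments s). dist y (?w - S s (R s ?w)) < e" by blast
qed

lemma scaleR_in_closure_span:
  fixes A :: "'b::real_normed_vector set"
  assumes "x \<in> closure (span A)"
  shows "c *\<^sub>R x \<in> closure (span A)"
proof -
  obtain y where "\<And>n. y n \<in> span A" "y \<longlonglongrightarrow> x" using assms unfolding closure_sequential by blast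
  then have "\<And>n. c *\<^sub>R y n \<in> span A" "(\<lambda>n. c *\<^sub>R y n) \<longlonglongrightarrow> c *\<^sub>R x"
    by (auto intro: span_scale tendsto_intros)
  then show ?thesis unfolding closure_sequential by (intro exI conjI allI)
qed

text \<open>The bounded projection \<open>?Q\<close> fixes the kernel of \<open>R s\<close>. It maps
  the averages of the \<open>R\<close>-orbit of \<open>v\<close> into the closure, and these images
  converge to \<open>v\<close>.\<close>

theorem kernel_subset_closure_increments:
  assumes "0 < s" and v: "R s v = 0"
  shows "v \<in> closure (span (increments s))"
proof -
  let ?Q = "\<lambda>x. x - S s (R s x)"
  have Q: "bounded_linear ?Q"
    using \<open>0 < s\<close> by (intro bounded_linear_sub bounded_linear_ident
      bounded_linear_compose[OF S.bounded_linear R.bounded_linear]) auto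
  have "?Q ((1 / h) *\<^sub>R R.I h v) \<in> closure (span (increments s))" if "0 < h" for h
  proof -
    have "?Q ((1 / h) *\<^sub>R R.I h v) = (1 / h) *\<^sub>R ?Q (R.I h v)"
      by (rule linear_simps(5)[OF Q])
    then show ?thesis
      using generator_domain_in_closure[of s h v] \<open>0 < s\<close> that
      by (simp only: scaleR_in_closure_span less_imp_le)
  qed
  then have "eventually (\<lambda>h. ?Q ((1 / h) *\<^sub>R R.I h v) \<in> closure (span (increments s))) (at_right 0)"
    by (simp add: eventually_at_filter)
  moreover have "((\<lambda>h. ?Q ((1 / h) *\<^sub>R R.I h v)) \<longlongrightarrow> ?Q v) (at_right 0)"
    by (rule bounded_linear.tendsto[OF Q R.average_tendsto])
  ultimately have "?Q v \<in> closure (span (increments s))"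
    by (intro Lim_in_closed_set[where F = "at_right 0"]) auto
  then show ?thesis using v \<open>0 < s\<close> by (simp add: S.zero)
qed

end

section \<open>Sum systems\<close>

lemma adj_spec:
  fixes A :: "'a::{real_inner,complete_space} \<Rightarrow> 'b::real_inner"
  assumes G1: "closed_subspace G1" and A: "bounded_op G1 G2 A"
  shows "adj G1 G2 A y \<in> G1" "x \<in> G1 \<Longrightarrow> A x \<bullet> y = x \<bullet> adj G1 G2 A y"
proof -
  from A obtain K where
    add: "\<And>x y. x \<in> G1 \<Longrightarrow> y \<in> G1 \<Longrightarrow> A (x + y) = A x + A y" and
    scale: "\<And>c x. x \<in> G1 \<Longrightarrow> A (c *\<^sub>R x) = c *\<^sub>R A x" and
    K: "\<And>x. x \<in> G1 \<Longrightarrow> norm (A x) \<le> K * norm x"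
    unfolding bounded_op_def by blast
  note proj = proj_in[OF G1] linear_simps[OF bounded_linear_proj[OF G1]]
  \<comment> \<open>Precomposition with the projection extends the functional from \<open>G1\<close>
    to the whole space, where the Riesz theorem applies; the representing vector is then projected
    back to \<open>G1\<close>.\<close>
  have "bounded_linear (\<lambda>x. A (proj G1 x) \<bullet> y)"
  proof (rule bounded_linear_intro)
    fix x
    have "norm (A (proj G1 x)) \<le> \<bar>K\<bar> * norm x"
      using K[OF proj(1), of x] mult_mono[OF abs_ge_self norm_proj_le[OF G1], of K x] by simp
    then have "norm (A (proj G1 x)) * norm y \<le> (\<bar>K\<bar> * norm x) * norm y"
      by (rule mult_right_mono) simp
    then show "norm (A (proj G1 x) \<bullet> y) \<le> norm x * (\<bar>K\<bar> * norm y)"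
      using Cauchy_Schwarz_ineq2[of "A (proj G1 x)" y] by (simp add: mult_ac)
  qed (simp_all add: proj add scale inner_add_left)
  then obtain r where r: "\<And>x. A (proj G1 x) \<bullet> y = x \<bullet> r"
    using riesz_representation by metis
  have "\<exists>!z. z \<in> G1 \<and> (\<forall>x\<in>G1. A x \<bullet> y = x \<bullet> z)"
  proof (rule ex1I[of _ "proj G1 r"])
    show "proj G1 r \<in> G1 \<and> (\<forall>x\<in>G1. A x \<bullet> y = x \<bullet> proj G1 r)"
      using r by (metis inner_proj[OF G1] proj_in[OF G1] proj_self[OF G1])
    show "z = proj G1 r" if "z \<in> G1 \<and> (\<forall>x\<in>G1. A x \<bullet> y = x \<bullet> z)" for z
      by (rule proj_eqI[OF G1, symmetric]) (use that r proj_self[OF G1] in \<open>simp_all\<close>, metis)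
  qed
  from theI'[OF this] show "adj G1 G2 A y \<in> G1" "x \<in> G1 \<Longrightarrow> A x \<bullet> y = x \<bullet> adj G1 G2 A y"
    unfolding adj_def by blast+
qed

text \<open>Surjectivity of \<open>A\<close> makes its adjoint injective on \<open>G2\<close>, so
  the preimage chosen by \<open>inv_into\<close> can only be \<open>y\<close>. Every inverse adjoint
  below is computed by testing inner products in this way.\<close>

lemma inv_adj_eqI:
  fixes A :: "'a::{real_inner,complete_space} \<Rightarrow> 'b::real_inner"
  assumes G1: "closed_subspace G1" and A: "bounded_op G1 G2 A" "A ` G1 = G2" and G2: "subspace G2"
    and "w \<in> G1" "y \<in> G2" and y: "\<And>x. x \<in> G1 \<Longrightarrow> A x \<bullet> y = x \<bullet> w"
  shows "inv_adj G1 G2 A w = y"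
proof -
  note adj = adj_spec[OF G1 A(1)]
  have sub: "subspace G1" using G1 by (simp add: closed_subspace_def)
  have "adj G1 G2 A y - w \<in> G1" using adj(1) \<open>w \<in> G1\<close> by (rule subspace_diff[OF sub])
  then have "(adj G1 G2 A y - w) \<bullet> (adj G1 G2 A y - w) = 0"
    using adj(2)[of _ y] y by (simp add: inner_diff_right)
  then have adj_y: "adj G1 G2 A y = w" by simp
  define y' where "y' = inv_adj G1 G2 A w"
  have "w \<in> adj G1 G2 A ` G2" using adj_y \<open>y \<in> G2\<close> by blast
  then have y': "y' \<in> G2" "adj G1 G2 A y' = w"
    unfolding y'_def inv_adj_def by (auto intro: inv_into_into f_inv_into_f)
  have "y' - y \<in> G2" using y'(1) \<open>y \<in> G2\<close> by (rule subspace_diff[OF G2])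
  then obtain x where x: "x \<in> G1" "A x = y' - y" using A(2) by auto
  have "A x \<bullet> y' = x \<bullet> w" using adj(2)[OF x(1), of y'] y'(2) by simp
  then have "A x \<bullet> (y' - y) = 0" using y[OF x(1)] by (simp add: inner_diff_right)
  then show ?thesis using x(2) y'_def by simp
qed

lemma closed_subspace_Times:
  "closed_subspace A \<Longrightarrow> closed_subspace B \<Longrightarrow> closed_subspace (A \<times> B)"
  by (simp add: closed_subspace_def subspace_Times closed_Times)

lemma bounded_op_sum2:
  assumes "(\<lambda>(u, v). u + v) ` (A \<times> B) \<subseteq> C"
  shows "bounded_op (A \<times> B) C (\<lambda>(u, v). u + v)"
  unfolding bounded_op_def
proof (intro conjI)
  have "norm (u + v) \<le> 2 * norm (u, v)" for u v :: 'a
    using norm_triangle_ineq[of u v] norm_fst_le[of u v] norm_snd_le[of v u] by linarith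
  then show "\<exists>K. \<forall>x\<in>A \<times> B. norm (case x of (u, v) \<Rightarrow> u + v) \<le> K * norm x" by auto
qed (use assms in \<open>auto simp: scaleR_add_right\<close>)

lemma bounded_op_sum3:
  assumes "(\<lambda>(u, v, w). u + v + w) ` (A \<times> B \<times> C) \<subseteq> D"
  shows "bounded_op (A \<times> B \<times> C) D (\<lambda>(u, v, w). u + v + w)"
  unfolding bounded_op_def
proof (intro conjI)
  have "norm (u + v + w) \<le> 3 * norm (u, v, w)" for u v w :: 'a
    using norm_triangle_ineq[of "u + v" w] norm_triangle_ineq[of u v] norm_fst_le[of u "(v, w)"]
      norm_snd_le[of "(v, w)" u] norm_fst_le[of v w] norm_snd_le[of w v] by linarith
  then show "\<exists>K. \<forall>x\<in>A \<times> B \<times> C. norm (case x of (u, v, w) \<Rightarrow> u + v + w) \<le> K * norm x" by auto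
qed (use assms in \<open>auto simp: scaleR_add_right\<close>)

lemma bounded_linear_imp_bounded_op:
  assumes "bounded_linear A" "A ` G1 \<subseteq> G2"
  shows "bounded_op G1 G2 A"
proof -
  obtain K where "\<forall>x. norm (A x) \<le> norm x * K" using bounded_linear.bounded[OF assms(1)] by blast
  then show ?thesis
    unfolding bounded_op_def using assms by (auto simp: linear_simps mult.commute)
qed

section \<open>The left inverse semigroup of a sum system\<close>

locale sum_sys =
  fixes G :: "real \<Rightarrow> ereal \<Rightarrow> 'a::{real_inner,complete_space} set" and S :: "real \<Rightarrow> 'a \<Rightarrow> 'a"
  assumes sum_system: "sum_system G S"

sublocale sum_sys \<subseteq> S: strongly_continuous_semigroup S
  using sum_system by unfold_locales (simp add: sum_system_def)

context sum_sys
begin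

lemma G_closed_subspace: "0 \<le> s \<Longrightarrow> ereal s < t \<Longrightarrow> closed_subspace (G s t)"
  using sum_system by (simp add: sum_system_def)

lemma G_subspace: "0 \<le> s \<Longrightarrow> ereal s < t \<Longrightarrow> subspace (G s t)"
  using G_closed_subspace by (simp add: closed_subspace_def)

lemma G_mono: "0 \<le> s' \<Longrightarrow> s' \<le> s \<Longrightarrow> ereal s < t \<Longrightarrow> t \<le> t' \<Longrightarrow> G s t \<subseteq> G s' t'"
  using sum_system unfolding sum_system_def by blast

lemma G_UNIV: "G 0 \<infinity> = UNIV"
  using sum_system by (simp add: sum_system_def)

lemma S_class_S: "0 < s \<Longrightarrow> 0 < t \<Longrightarrow> S s \<in> S_class (G 0 t) (G s (ereal s + t))"
  using sum_system by (simp add: sum_system_def)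

lemma S_class_sum:
  "0 < s \<Longrightarrow> 0 < t \<Longrightarrow> (\<lambda>(x, y). x + y) \<in>
    S_class (G 0 (ereal s) \<times> G s (ereal s + t)) (G 0 (ereal s + t))"
  using sum_system by (simp add: sum_system_def)

lemma S_image:
  assumes "0 \<le> s" "0 < t"
  shows "S s ` G 0 (ereal t) = G s (ereal (s + t))"
proof (cases "s = 0")
  case True
  then show ?thesis by (simp add: S.at_0)
next
  case False
  then show ?thesis
    using S_class_S[of s "ereal t"] assms by (simp add: S_class_def bij_betw_def)
qed

lemma S_range: "0 < s \<Longrightarrow> range (S s) = G s \<infinity>"
  using S_class_S[of s \<infinity>] by (simp add: S_class_def bij_betw_def G_UNIV)

lemma G_sum:
  assumes "0 < s" "0 < t"
  shows "(\<lambda>(u, v). u + v) ` (G 0 (ereal s) \<times> G s (ereal (s + t))) = G 0 (ereal (s + t))"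
  using S_class_sum[of s "ereal t"] assms by (simp add: S_class_def bij_betw_def)

lemma decomposition:
  assumes "0 < s"
  obtains u v where "u \<in> G 0 (ereal s)" "z = u + S s v"
proof -
  have "(\<lambda>(x, y). x + y) ` (G 0 (ereal s) \<times> G s \<infinity>) = UNIV"
    using S_class_sum[of s \<infinity>] assms by (simp add: S_class_def bij_betw_def G_UNIV)
  then have "z \<in> (\<lambda>(x, y). x + y) ` (G 0 (ereal s) \<times> G s \<infinity>)" by simp
  then obtain u x where "u \<in> G 0 (ereal s)" "x \<in> G s \<infinity>" "z = u + x" by auto
  moreover from this obtain v where "x = S s v" using S_range[OF assms] by (metis rangeE)
  ultimately show ?thesis using that by blast
qed

text \<open>Composes the bounded inverses of the sum map and of \<open>S s\<close>, both taken with
  t = oo. The estimate gives uniqueness of \<open>v\<close> (when the sum is 0) as well as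
  boundedness of \<open>R s\<close>.\<close>

lemma decomposition_bounded:
  assumes "0 < s"
  obtains K where "\<And>u v. u \<in> G 0 (ereal s) \<Longrightarrow> norm v \<le> K * norm (u + S s v)"
proof -
  let ?P = "G 0 (ereal s) \<times> G s \<infinity>" and ?A = "\<lambda>(x, y). x + y :: 'a"
  have A: "inj_on ?A ?P" "bounded_op UNIV ?P (inv_into ?P ?A)"
    using S_class_sum[of s \<infinity>] assms by (simp_all add: S_class_def bij_betw_def G_UNIV)
  have B: "inj (S s)" "bounded_op (G s \<infinity>) UNIV (inv (S s))"
    using S_class_S[of s \<infinity>] assms by (simp_all add: S_class_def bij_betw_def G_UNIV)
  obtain K1 where K1: "\<And>z. norm (inv_into ?P ?A z) \<le> K1 * norm z"
    using A(2) unfolding bounded_op_def by blast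
  obtain K2 where K2: "\<And>x. x \<in> G s \<infinity> \<Longrightarrow> norm (inv (S s) x) \<le> K2 * norm x"
    using B(2) unfolding bounded_op_def by blast
  have "norm v \<le> (\<bar>K2\<bar> * K1) * norm (u + S s v)" if u: "u \<in> G 0 (ereal s)" for u v
  proof -
    have Sv: "S s v \<in> G s \<infinity>" using S_range[OF assms] by blast
    have "inv_into ?P ?A (u + S s v) = (u, S s v)"
      using inv_into_f_f[OF A(1), of "(u, S s v)"] u Sv by simp
    then have "norm (u, S s v) \<le> K1 * norm (u + S s v)" using K1 by metis
    then have "norm (S s v) \<le> K1 * norm (u + S s v)"
      using norm_snd_le[of "S s v" u] by linarith
    then have "\<bar>K2\<bar> * norm (S s v) \<le> \<bar>K2\<bar> * (K1 * norm (u + S s v))"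
      by (rule mult_left_mono) simp
    moreover have "norm v \<le> K2 * norm (S s v)"
      using K2[OF Sv] inv_f_f[OF B(1)] by simp
    moreover have "K2 * norm (S s v) \<le> \<bar>K2\<bar> * norm (S s v)"
      by (intro mult_right_mono) auto
    ultimately show ?thesis by (simp add: mult.assoc)
  qed
  then show ?thesis by (rule that)
qed

text \<open>The case s = 0 is set by hand because \<open>G 0 0\<close> has no meaning. For s > 0 the
  choice is unique by \<open>R_eq\<close>.\<close>

definition R :: "real \<Rightarrow> 'a \<Rightarrow> 'a" where
  "R s z = (if s \<le> 0 then z else (SOME v. \<exists>u\<in>G 0 (ereal s). z = u + S s v))"

lemma R_0: "R 0 z = z" by (simp add: R_def)

lemma R_eq:
  assumes "0 < s" and u: "u \<in> G 0 (ereal s)"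
  shows "R s (u + S s v) = v"
proof -
  obtain K where K: "\<And>u v. u \<in> G 0 (ereal s) \<Longrightarrow> norm v \<le> K * norm (u + S s v)"
    using decomposition_bounded[OF \<open>0 < s\<close>] by blast
  have "\<exists>v'. \<exists>u'\<in>G 0 (ereal s). u + S s v = u' + S s v'" using u by blast
  from someI_ex[OF this] obtain u' where u': "u' \<in> G 0 (ereal s)" "u + S s v = u' + S s (R s (u + S s v))"
    using \<open>0 < s\<close> by (auto simp: R_def)
  have "u - u' \<in> G 0 (ereal s)"
    using u u'(1) \<open>0 < s\<close> by (intro subspace_diff[OF G_subspace]) auto
  moreover have "(u - u') + S s (v - R s (u + S s v)) = 0"
    using u'(2) \<open>0 < s\<close> by (simp add: S.diff algebra_simps)
  ultimately show ?thesis using K[of "u - u'" "v - R s (u + S s v)"] by simp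
qed

lemma R_S:
  assumes "0 \<le> s"
  shows "R s (S s v) = v"
proof (cases "s = 0")
  case False
  then have "0 \<in> G 0 (ereal s)" using assms by (intro subspace_0 G_subspace) auto
  then show ?thesis using R_eq[of s 0 v] False assms by simp
qed (simp add: R_0 S.at_0)

lemma R_eq_0_iff:
  assumes "0 < s"
  shows "R s z = 0 \<longleftrightarrow> z \<in> G 0 (ereal s)"
proof -
  obtain u v where uv: "u \<in> G 0 (ereal s)" "z = u + S s v" using decomposition[OF assms] .
  have "z \<in> G 0 (ereal s) \<Longrightarrow> R s z = 0"
    using R_eq[OF assms, of z 0] assms by (simp add: S.zero)
  moreover have "R s z = 0 \<Longrightarrow> z \<in> G 0 (ereal s)"
    using R_eq[OF assms uv(1), of v] uv assms by (simp add: S.zero)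
  ultimately show ?thesis by blast
qed

lemma R_bounded_linear:
  assumes "0 \<le> s"
  shows "bounded_linear (R s)"
proof (cases "s = 0")
  case True
  then have "R s = (\<lambda>x. x)" by (simp add: R_0 fun_eq_iff)
  then show ?thesis by (simp add: bounded_linear_ident)
next
  case False
  then have s: "0 < s" using assms by simp
  obtain K where K: "\<And>u v. u \<in> G 0 (ereal s) \<Longrightarrow> norm v \<le> K * norm (u + S s v)"
    using decomposition_bounded[OF s] by blast
  have sub: "subspace (G 0 (ereal s))" using s by (intro G_subspace) auto
  show ?thesis
  proof (rule bounded_linear_intro[where K = K])
    fix x y c
    obtain u v where uv: "u \<in> G 0 (ereal s)" "x = u + S s v" using decomposition[OF s] .
    obtain u' v' where uv': "u' \<in> G 0 (ereal s)" "y = u' + S s v'" using decomposition[OF s] .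
    have Rx: "R s x = v" and Ry: "R s y = v'" using R_eq[OF s] uv uv' by simp_all
    have "x + y = (u + u') + S s (v + v')" using uv uv' assms by (simp add: S.add)
    then show "R s (x + y) = R s x + R s y"
      unfolding Rx Ry by (simp only: R_eq[OF s subspace_add[OF sub uv(1) uv'(1)]])
    have "c *\<^sub>R x = c *\<^sub>R u + S s (c *\<^sub>R v)" using uv assms by (simp add: S.scaleR scaleR_add_right)
    then show "R s (c *\<^sub>R x) = c *\<^sub>R R s x"
      unfolding Rx by (simp only: R_eq[OF s subspace_scale[OF sub uv(1)]])
    show "norm (R s x) \<le> norm x * K" using R_eq[OF s uv(1), of v] K[OF uv(1)] uv by (simp add: mult.commute)
  qed
qed

text \<open>Decompose twice: z = u + S_t (u' + S_s v'). The part u + S_t u' lies in G_{0,t} +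
  G_{t,t+s} = G_{0,s+t}, so v' is also the component for time s + t.\<close>

lemma R_semigroup:
  assumes "0 \<le> s" "0 \<le> t"
  shows "R (s + t) z = R s (R t z)"
proof (cases "s = 0 \<or> t = 0")
  case False
  then have s: "0 < s" and t: "0 < t" using assms by auto
  obtain u v where uv: "u \<in> G 0 (ereal t)" "z = u + S t v" using decomposition[OF t] .
  obtain u' v' where uv': "u' \<in> G 0 (ereal s)" "v = u' + S s v'" using decomposition[OF s] .
  have z: "z = (u + S t u') + S (s + t) v'"
    using uv uv' s t by (simp add: S.add S.semigroup[symmetric] add.commute[of t s])
  have "S t u' \<in> G t (ereal (t + s))" using S_image[of t s] uv'(1) s t by auto
  then have "u + S t u' \<in> G 0 (ereal (t + s))" using G_sum[OF t s] uv(1) by force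
  then have "R (s + t) z = v'"
    using R_eq[of "s + t" "u + S t u'" v'] s t z by (simp add: add.commute)
  then show ?thesis using R_eq[OF t uv(1), of v] R_eq[OF s uv'(1), of v'] uv uv' by simp
qed (auto simp: R_0)

lemma R_tendsto: "((\<lambda>t. R t x) \<longlongrightarrow> x) (at_right 0)"
proof -
  have "continuous_on {0..1} (\<lambda>t. S (1 - t) x)"
    by (rule continuous_on_compose2[OF S.continuous[of 1 x]]) (auto intro!: continuous_intros)
  then have "((\<lambda>t. S (1 - t) x) \<longlongrightarrow> S 1 x) (at 0 within {0..1})"
    unfolding continuous_on_def by (auto dest: bspec[of _ _ 0])
  then have "((\<lambda>t. S (1 - t) x) \<longlongrightarrow> S 1 x) (at_right 0)"
    by (simp add: at_within_Icc_at_right)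
  then have "((\<lambda>t. R 1 (S (1 - t) x)) \<longlongrightarrow> R 1 (S 1 x)) (at_right 0)"
    by (rule bounded_linear.tendsto[OF R_bounded_linear, rotated]) simp
  moreover have "eventually (\<lambda>t. R 1 (S (1 - t) x) = R t x) (at_right 0)"
  proof (rule eventually_mono[OF eventually_at_right_real[of 0 1]])
    fix t :: real assume "t \<in> {0<..<1}"
    then show "R 1 (S (1 - t) x) = R t x"
      using R_semigroup[of t "1 - t" "S (1 - t) x"] R_S[of "1 - t" x] by simp
  qed simp
  ultimately show ?thesis using R_S[of 1 x] by (auto intro: Lim_transform_eventually)
qed

end

sublocale sum_sys \<subseteq> left_inverse_semigroups S R
  by unfold_locales
    (auto simp: C0_semigroup_def R_bounded_linear R_0 R_semigroup R_tendsto R_S)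

section \<open>The dual pair of semigroups\<close>

abbreviation (in sum_sys) T :: "real \<Rightarrow> 'a \<Rightarrow> 'a" where "T t \<equiv> adjoint (R t)"
abbreviation (in sum_sys) S' :: "real \<Rightarrow> 'a \<Rightarrow> 'a" where "S' t \<equiv> adjoint (S t)"

context sum_sys
begin

lemma inner_T: "0 \<le> t \<Longrightarrow> x \<bullet> T t y = R t x \<bullet> y"
  by (rule inner_adjoint[OF R_bounded_linear])

lemma inner_S': "0 \<le> t \<Longrightarrow> x \<bullet> S' t y = S t x \<bullet> y"
  by (rule inner_adjoint[OF S.bounded_linear])

lemma S'_T:
  assumes "0 \<le> t"
  shows "S' t (T t x) = x"
proof -
  have "y \<bullet> S' t (T t x) = y \<bullet> x" for y using assms by (simp add: inner_S' inner_T R_S)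
  then show ?thesis using vector_eq_ldot by blast
qed

end

text \<open>Taking adjoints reverses products, so R_t S_t = 1 makes \<open>S' t\<close> a left
  inverse of \<open>T t\<close>. For t > 0 the kernel of \<open>S' t\<close> is the orthogonal
  complement of \<open>G t \<infinity>\<close>, the range of \<open>S t\<close>.\<close>

sublocale sum_sys \<subseteq> dual: left_inverse_semigroups T S'
  by unfold_locales (auto intro: S.C0_semigroup_adjoint R.C0_semigroup_adjoint S'_T)

context sum_sys
begin

text \<open>The kernel of \<open>R s\<close> is G_{0,s}, so cocycles are real addits and the density
  theorem gives one inclusion; the other holds because \<open>S s1\<close> maps G_{0,s2-s1} into
  G_{s1,s2}.\<close>

theorem G_eq_closure_real_incr:
  assumes "0 < s"
  shows "G 0 (ereal s) = closure (span
    {real_incr S x s1 s2 | x s1 s2. 0 \<le> s1 \<and> s1 < s2 \<and> s2 \<le> s \<and> x \<in> real_addits G S})"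
    (is "_ = closure (span ?X)")
proof
  have "cocycles S R \<subseteq> real_addits G S"
  proof
    fix x assume x: "x \<in> cocycles S R"
    have "weakly_measurable x"
      unfolding weakly_measurable_def
      using x by (auto simp: cocycles_def intro: borel_measurable_continuous_on_restrict)
    then show "x \<in> real_addits G S" using x by (auto simp: cocycles_def real_addits_def R_eq_0_iff)
  qed
  then have "increments s \<subseteq> ?X" unfolding increments_def real_incr_def by blast
  then have "closure (span (increments s)) \<subseteq> closure (span ?X)"
    by (intro closure_mono span_mono)
  then show "G 0 (ereal s) \<subseteq> closure (span ?X)"
    using kernel_subset_closure_increments[OF assms] R_eq_0_iff[OF assms] by blast
next
  have "real_incr S x s1 s2 \<in> G 0 (ereal s)"
    if "0 \<le> s1" "s1 < s2" "s2 \<le> s" "x \<in> real_addits G S" for x s1 s2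
  proof -
    have "x (s2 - s1) \<in> G 0 (ereal (s2 - s1))" using that by (simp add: real_addits_def)
    then have "real_incr S x s1 s2 \<in> G s1 (ereal s2)"
      using S_image[of s1 "s2 - s1"] that by (auto simp: real_incr_def)
    then show ?thesis using G_mono[of 0 s1 "ereal s2" "ereal s"] that by auto
  qed
  moreover have "closed_subspace (G 0 (ereal s))" using assms by (intro G_closed_subspace) auto
  ultimately show "closure (span ?X) \<subseteq> G 0 (ereal s)"
    unfolding closed_subspace_def by (intro closure_minimal span_minimal) auto
qed

section \<open>Imaginary increments as projections of shifted functionals\<close>

lemma summand_closed_subspace: "0 \<le> s \<Longrightarrow> closed_subspace (summand G s t)"
  unfolding summand_def using G_closed_subspace[of s "ereal t"]
  by (auto simp: closed_subspace_def subspace_def)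

lemma summand_0: "v \<in> summand G s t \<Longrightarrow> \<not> s < t \<Longrightarrow> v = 0"
  by (simp add: summand_def)

lemma summand_sum:
  assumes "0 \<le> s" "s \<le> t"
  shows "(\<lambda>(u, v). u + v) ` (summand G 0 s \<times> summand G s t) = summand G 0 t"
proof (cases "0 < s \<and> s < t")
  case True
  then show ?thesis using G_sum[of s "t - s"] by (simp add: summand_def)
next
  case False
  then consider "s = 0" | "s = t" using assms by linarith
  then show ?thesis by cases (force simp: summand_def)+
qed

lemma summand_sum3:
  assumes "0 \<le> s1" "s1 < s2" "s2 \<le> s"
  shows "(\<lambda>(u, v, w). u + v + w) ` (summand G 0 s1 \<times> summand G s1 s2 \<times> summand G s2 s) = G 0 (ereal s)"
proof -
  have "(\<lambda>(u, v, w). u + v + w) ` (summand G 0 s1 \<times> summand G s1 s2 \<times> summand G s2 s)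
      = (\<lambda>(u, v). u + v) ` ((\<lambda>(u, v). u + v) ` (summand G 0 s1 \<times> summand G s1 s2) \<times> summand G s2 s)"
    by force
  also have "\<dots> = (\<lambda>(u, v). u + v) ` (summand G 0 s2 \<times> summand G s2 s)"
    using summand_sum[of s1 s2] assms by simp
  also have "\<dots> = G 0 (ereal s)" using summand_sum[of s2 s] assms by (simp add: summand_def)
  finally show ?thesis .
qed

abbreviation E :: "real \<Rightarrow> 'a \<Rightarrow> 'a" where "E t \<equiv> proj (G 0 (ereal t))"

text \<open>As functionals: \<open>T s y\<close> takes on \<open>S s x\<close> the value of
  \<open>y\<close> on \<open>x\<close>, so it is the transported functional, and the projection
  picks its representative inside G_{s,s+t}.\<close>

lemma inv_adj_S:
  assumes "0 \<le> s" "0 < t"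
  shows "inv_adj (G 0 (ereal t)) (G s (ereal (s + t))) (S s) (E t y) = proj (G s (ereal (s + t))) (T s y)"
proof (rule inv_adj_eqI)
  have G1: "closed_subspace (G 0 (ereal t))" and G2: "closed_subspace (G s (ereal (s + t)))"
    using assms by (auto intro: G_closed_subspace)
  show "closed_subspace (G 0 (ereal t))" by fact
  show im: "S s ` G 0 (ereal t) = G s (ereal (s + t))" using assms by (rule S_image)
  then show "bounded_op (G 0 (ereal t)) (G s (ereal (s + t))) (S s)"
    by (intro bounded_linear_imp_bounded_op S.bounded_linear assms) simp
  show "subspace (G s (ereal (s + t)))" using G2 by (simp add: closed_subspace_def)
  show "E t y \<in> G 0 (ereal t)" by (rule proj_in[OF G1])
  show "proj (G s (ereal (s + t))) (T s y) \<in> G s (ereal (s + t))" by (rule proj_in[OF G2])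
  fix x assume x: "x \<in> G 0 (ereal t)"
  then have "S s x \<in> G s (ereal (s + t))" using im by blast
  then show "S s x \<bullet> proj (G s (ereal (s + t))) (T s y) = x \<bullet> E t y"
    using x assms by (simp add: inner_proj[OF G1] inner_proj[OF G2] inner_T R_S)
qed

lemma imag_incr_eq:
  assumes "0 \<le> s" "s < t" and y: "y (t - s) = E (t - s) y'"
  shows "imag_incr G S y s t = proj (G s (ereal t)) (T s y')"
  using inv_adj_S[of s "t - s" y'] assms by (simp add: imag_incr_def)

text \<open>The functional \<open>T s1 y'\<close> already is the extension by zero: it vanishes on
  G_{0,s1}, which \<open>R s1\<close> kills, and on G_{s2,s}, which \<open>R s1\<close> maps into
  the range of \<open>S (s2 - s1)\<close>, where \<open>y'\<close> vanishes.\<close>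

lemma imag_incr'_eq:
  assumes s: "0 \<le> s1" "s1 < s2" "s2 \<le> s"
    and y: "y (s2 - s1) = E (s2 - s1) y'" and y': "S' (s2 - s1) y' = 0"
  shows "imag_incr' G S s y s1 s2 = E s (T s1 y')"
  unfolding imag_incr'_def imag_incr_eq[OF s(1,2), of y, OF y]
proof (rule inv_adj_eqI)
  let ?P = "summand G 0 s1 \<times> summand G s1 s2 \<times> summand G s2 s"
  have G: "closed_subspace (G 0 (ereal s))" and G12: "closed_subspace (G s1 (ereal s2))"
    using s by (auto intro: G_closed_subspace)
  show "closed_subspace ?P" using s by (intro closed_subspace_Times summand_closed_subspace) auto
  show im: "(\<lambda>(u, v, w). u + v + w) ` ?P = G 0 (ereal s)" by (rule summand_sum3[OF s])
  then show "bounded_op ?P (G 0 (ereal s)) (\<lambda>(u, v, w). u + v + w)"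
    by (intro bounded_op_sum3) simp
  show "subspace (G 0 (ereal s))" using G by (simp add: closed_subspace_def)
  have "0 \<in> summand G 0 s1" "0 \<in> summand G s2 s"
    using summand_closed_subspace[of 0 s1] summand_closed_subspace[of s2 s] s
    by (auto simp: closed_subspace_def subspace_0)
  then show "(0, proj (G s1 (ereal s2)) (T s1 y'), 0) \<in> ?P"
    using proj_in[OF G12] s by (simp add: summand_def)
  show "E s (T s1 y') \<in> G 0 (ereal s)" by (rule proj_in[OF G])
  fix x assume "x \<in> ?P"
  then obtain u v w where x: "x = (u, v, w)" and
    uvw: "u \<in> summand G 0 s1" "v \<in> summand G s1 s2" "w \<in> summand G s2 s" by auto
  have "u + v + w \<in> G 0 (ereal s)" using uvw im by force
  then have "(u + v + w) \<bullet> E s (T s1 y') = (u + v + w) \<bullet> T s1 y'" by (rule inner_proj[OF G])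
  then have "(u + v + w) \<bullet> E s (T s1 y') = u \<bullet> T s1 y' + v \<bullet> T s1 y' + w \<bullet> T s1 y'"
    by (simp only: inner_add_left)
  moreover have "R s1 u = 0"
  proof (cases "0 < s1")
    case True
    then show ?thesis using uvw(1) by (simp add: R_eq_0_iff summand_def)
  qed (use summand_0[OF uvw(1)] R.zero s in auto)
  then have "u \<bullet> T s1 y' = 0" using s by (simp add: inner_T)
  moreover have "v \<bullet> T s1 y' = v \<bullet> proj (G s1 (ereal s2)) (T s1 y')"
    using uvw(2) s by (simp add: inner_proj[OF G12] summand_def)
  moreover have "w \<bullet> T s1 y' = 0"
  proof (cases "s2 < s")
    case True
    then have "w \<in> S s2 ` G 0 (ereal (s - s2))"
      using uvw(3) S_image[of s2 "s - s2"] s by (simp add: summand_def)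
    then obtain w' where "w = S s2 w'" by blast
    then have "R s1 w = S (s2 - s1) w'"
      using S.semigroup[of s1 "s2 - s1" w'] s by (simp add: R_S)
    then have "w \<bullet> T s1 y' = w' \<bullet> S' (s2 - s1) y'" using s by (simp add: inner_T inner_S')
    then show ?thesis by (simp add: y')
  qed (use summand_0[OF uvw(3)] in simp)
  ultimately show "(case x of (u, v, w) \<Rightarrow> u + v + w) \<bullet> E s (T s1 y')
      = x \<bullet> (0, proj (G s1 (ereal s2)) (T s1 y'), 0)"
    by (simp add: x inner_prod_def)
qed

text \<open>\<open>z - T\<^sub>t S\<^sub>t\<^sup>* z\<close> is the functional \<open>z\<close> on \<open>G\<^sub>0\<^sub>,\<^sub>t\<close>, extended by zero on \<open>G\<^sub>t\<^sub>,\<^sub>\<infinity>\<close>.\<close>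

lemma zero_extension:
  assumes "0 < t" "z \<in> G 0 (ereal t)"
  shows "E t (z - T t (S' t z)) = z" "S' t (z - T t (S' t z)) = 0"
proof -
  show "E t (z - T t (S' t z)) = z"
  proof (rule proj_eqI)
    show "closed_subspace (G 0 (ereal t))" using assms by (intro G_closed_subspace) auto
    show "x \<bullet> z = x \<bullet> (z - T t (S' t z))" if "x \<in> G 0 (ereal t)" for x
      using that assms R_eq_0_iff[of t x] by (simp add: inner_diff_right inner_T)
  qed fact
  show "S' t (z - T t (S' t z)) = 0" using assms by (simp add: dual.R.diff S'_T)
qed

lemma E_mono: "0 < t \<Longrightarrow> t \<le> t' \<Longrightarrow> norm (E t z) \<le> norm (E t' z)"
  using proj_proj_subset[of "G 0 (ereal t)" "G 0 (ereal t')" z]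
    norm_proj_le[of "G 0 (ereal t)" "E t' z"] G_mono[of 0 0 "ereal t" "ereal t'"]
    G_closed_subspace[of 0 "ereal t"] G_closed_subspace[of 0 "ereal t'"]
  by simp

text \<open>The norm of \<open>E t z\<close> increases with t because the subspaces do, and monotone
  functions are measurable; polarisation recovers the inner products.\<close>

lemma E_measurable: "(\<lambda>t. E t u \<bullet> v) \<in> borel_measurable (restrict_space borel {0<..})"
proof -
  have G: "closed_subspace (G 0 (ereal t))" if "0 < t" for t
    using that by (intro G_closed_subspace) auto
  have pol: "E t u \<bullet> v = ((norm (E t (u + v)))\<^sup>2 - (norm (E t (u - v)))\<^sup>2) / 4" if "0 < t" for t
  proof -
    note lin = linear_simps[OF bounded_linear_proj[OF G[OF that]]]
    have "E t u \<bullet> v = E t u \<bullet> E t v"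
      using inner_proj[OF G[OF that] proj_in[OF G[OF that]], of u v] by simp
    then show ?thesis
      by (simp add: lin power2_norm_eq_inner inner_add inner_diff inner_commute)
  qed
  have mono: "(\<lambda>t. (norm (E t z))\<^sup>2) \<in> borel_measurable (restrict_space borel {0<..})" for z
    by (rule borel_measurable_mono_on_fnc) (auto intro!: mono_onI power_mono E_mono)
  have "(\<lambda>t. ((norm (E t (u + v)))\<^sup>2 - (norm (E t (u - v)))\<^sup>2) / 4)
      \<in> borel_measurable (restrict_space borel {0<..})"
    using mono by measurable
  then show ?thesis
    by (subst measurable_cong[OF pol]) (auto simp: space_restrict_space)
qed

text \<open>\<open>E t (y t)\<close> represents the restriction of the functional \<open>y t\<close>
  to G_{0,t}. Additivity is tested on u + v with u in G_{0,s} and v in G_{s,s+t}: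
  \<open>T s (y t)\<close> vanishes on u and \<open>y s\<close> on v.\<close>

lemma cocycle_imp_imag_addit:
  assumes y: "y \<in> cocycles T S'"
  shows "(\<lambda>t. E t (y t)) \<in> imag_addits G S"
  unfolding imag_addits_def
proof (intro CollectI conjI allI impI)
  have ker: "S' t (y t) = 0" if "0 < t" for t using y that by (simp add: cocycles_def)
  have add: "y (s + t) = y s + T s (y t)" if "0 < s" "0 < t" for s t
    using y that by (simp add: cocycles_def)
  have G: "closed_subspace (G 0 (ereal t))" if "0 < t" for t
    using that by (intro G_closed_subspace) auto
  show "E t (y t) \<in> G 0 (ereal t)" if "0 < t" for t
    by (rule proj_in[OF G[OF that]])
  \<comment> \<open>On G_{0,t} all functionals \<open>y t'\<close> with t' >= t agree, as their
    difference from \<open>y t\<close> factors through \<open>R t\<close>.\<close>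
  have restrict: "E t (y t') = E t (y t)" if "0 < t" "t \<le> t'" for t t'
  proof (cases "t = t'")
    case False
    show ?thesis
    proof (rule proj_eqI[OF G[OF \<open>0 < t\<close>] proj_in[OF G[OF \<open>0 < t\<close>]]])
      fix x assume x: "x \<in> G 0 (ereal t)"
      have "R t x = 0" using x by (simp add: R_eq_0_iff[OF \<open>0 < t\<close>])
      moreover have "x \<bullet> y t' = x \<bullet> y t + R t x \<bullet> y (t' - t)"
        using add[of t "t' - t"] that False by (simp add: inner_add_right inner_T)
      ultimately show "x \<bullet> E t (y t) = x \<bullet> y t'"
        using x by (simp add: inner_proj[OF G[OF \<open>0 < t\<close>]])
    qed
  qed simp
  show "weakly_measurable (\<lambda>t. E t (y t))"
    unfolding weakly_measurable_def
  proof
    fix v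
    let ?M = "restrict_space borel {0<..} :: real measure"
    have [measurable]: "(\<lambda>t. t) \<in> borel_measurable ?M" by (rule measurable_restrict_space1) simp
    \<comment> \<open>By \<open>restrict\<close>, \<open>y\<close> may be frozen at time n for all t
      <= n. Then only the projection varies with t, so \<open>E_measurable\<close> applies, and at
      each t the sequence is eventually constant.\<close>
    define f where "f n t = (if t \<le> real n then E t (y (real n)) \<bullet> v else 0)" for n t
    have "(\<lambda>t. E t (y t) \<bullet> v) \<in> borel_measurable ?M"
    proof (rule borel_measurable_LIMSEQ_real)
      show "f n \<in> borel_measurable ?M" for n
        unfolding f_def by (intro measurable_If E_measurable measurable_const) measurable
      fix t assume "t \<in> space ?M"
      then have "0 < t" by (simp add: space_restrict_space)
      obtain N where "t \<le> real N" using real_arch_simple by blast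
      then have "f n t = E t (y t) \<bullet> v" if "N \<le> n" for n
        using that restrict[OF \<open>0 < t\<close>, of "real n"] by (simp add: f_def)
      then have "eventually (\<lambda>n. f n t = E t (y t) \<bullet> v) sequentially"
        unfolding eventually_sequentially by blast
      then show "(\<lambda>n. f n t) \<longlonglongrightarrow> E t (y t) \<bullet> v" by (rule tendsto_eventually)
    qed
    then show "(\<lambda>t. E t (y t) \<bullet> v) \<in> borel_measurable ?M" .
  qed
  fix s t :: real assume s: "0 < s" and t: "0 < t"
  let ?H = "G s (ereal (s + t))"
  have H: "closed_subspace ?H" using s t by (intro G_closed_subspace) auto
  have st: "closed_subspace (G 0 (ereal (s + t)))" using s t by (intro G) simp
  show "inv_adj (G 0 (ereal s) \<times> ?H) (G 0 (ereal (s + t))) (\<lambda>(u, v). u + v)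
      (E s (y s), inv_adj (G 0 (ereal t)) ?H (S s) (E t (y t))) = E (s + t) (y (s + t))"
    unfolding inv_adj_S[OF less_imp_le[OF s] t]
  proof (rule inv_adj_eqI)
    show "closed_subspace (G 0 (ereal s) \<times> ?H)" by (intro closed_subspace_Times G s H)
    show im: "(\<lambda>(u, v). u + v) ` (G 0 (ereal s) \<times> ?H) = G 0 (ereal (s + t))" by (rule G_sum[OF s t])
    then show "bounded_op (G 0 (ereal s) \<times> ?H) (G 0 (ereal (s + t))) (\<lambda>(u, v). u + v)"
      by (intro bounded_op_sum2) simp
    show "subspace (G 0 (ereal (s + t)))" using st by (simp add: closed_subspace_def)
    show "(E s (y s), proj ?H (T s (y t))) \<in> G 0 (ereal s) \<times> ?H"
      by (simp add: proj_in G s H)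
    show "E (s + t) (y (s + t)) \<in> G 0 (ereal (s + t))" by (rule proj_in[OF st])
    fix x assume "x \<in> G 0 (ereal s) \<times> ?H"
    then obtain u v where x: "x = (u, v)" and uv: "u \<in> G 0 (ereal s)" "v \<in> ?H" by auto
    have "u + v \<in> G 0 (ereal (s + t))" using uv im by force
    then have "(u + v) \<bullet> E (s + t) (y (s + t)) = (u + v) \<bullet> (y s + T s (y t))"
      by (simp add: inner_proj[OF st] add[OF s t])
    moreover have "u \<bullet> T s (y t) = 0" using uv(1) s by (simp add: inner_T R_eq_0_iff[THEN iffD2])
    moreover have "v \<bullet> y s = 0"
    proof -
      obtain v' where "v = S s v'" using uv(2) S_image[of s t] s t by auto
      then show ?thesis using inner_S'[of s v' "y s"] ker[OF s] s by simp
    qed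
    ultimately show "(case x of (u, v) \<Rightarrow> u + v) \<bullet> E (s + t) (y (s + t))
        = x \<bullet> (E s (y s), proj ?H (T s (y t)))"
      using uv by (simp add: x inner_prod_def inner_add inner_proj[OF G[OF s]] inner_proj[OF H])
  qed
qed

text \<open>Each z in G_{0,s} is the projection of its zero extension, which lies in the kernel of
  \<open>S' s\<close>. The density theorem for the dual pair applies to that extension, and the
  bounded map \<open>E s\<close> carries the approximation back to z.\<close>

theorem G_eq_closure_imag_incr:
  assumes "0 < s"
  shows "G 0 (ereal s) = closure (span
    {imag_incr' G S s y s1 s2 | y s1 s2. 0 \<le> s1 \<and> s1 < s2 \<and> s2 \<le> s \<and> y \<in> imag_addits G S})"
    (is "_ = closure (span ?Y)")
proof
  have G: "closed_subspace (G 0 (ereal s))" using assms by (intro G_closed_subspace) auto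
  have "E s ` dual.increments s \<subseteq> ?Y"
  proof
    fix z assume "z \<in> E s ` dual.increments s"
    then obtain y s1 s2 where y: "0 \<le> s1" "s1 < s2" "s2 \<le> s" "y \<in> cocycles T S'"
      and z: "z = E s (T s1 (y (s2 - s1)))"
      unfolding dual.increments_def by blast
    then have "S' (s2 - s1) (y (s2 - s1)) = 0" by (simp add: cocycles_def)
    then have "z = imag_incr' G S s (\<lambda>t. E t (y t)) s1 s2"
      using imag_incr'_eq[OF y(1-3), of "\<lambda>t. E t (y t)" "y (s2 - s1)"] z by simp
    then show "z \<in> ?Y" using y cocycle_imp_imag_addit[OF y(4)] by blast
  qed
  then have sub: "closure (span (E s ` dual.increments s)) \<subseteq> closure (span ?Y)"
    by (intro closure_mono span_mono)
  show "G 0 (ereal s) \<subseteq> closure (span ?Y)"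
  proof
    fix z assume "z \<in> G 0 (ereal s)"
    from zero_extension[OF assms this] obtain z' where z': "E s z' = z" "S' s z' = 0" by blast
    have "z' \<in> closure (span (dual.increments s))"
      by (rule dual.kernel_subset_closure_increments[OF assms z'(2)])
    then have "z \<in> E s ` closure (span (dual.increments s))" using z'(1) by blast
    also have "\<dots> \<subseteq> closure (E s ` span (dual.increments s))"
      by (rule closure_bounded_linear_image_subset[OF bounded_linear_proj[OF G]])
    also have "E s ` span (dual.increments s) = span (E s ` dual.increments s)"
      by (rule linear_span_image[symmetric])
        (rule bounded_linear.linear[OF bounded_linear_proj[OF G]])
    finally show "z \<in> closure (span ?Y)" using sub by blast
  qed
  have "imag_incr' G S s y s1 s2 \<in> G 0 (ereal s)"
    if y: "0 \<le> s1" "s1 < s2" "s2 \<le> s" "y \<in> imag_addits G S" for y s1 s2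
  proof -
    \<comment> \<open>An arbitrary imaginary addit need not come with a cocycle, but the increment
      involves its value at the single time s2 - s1, and the zero extension of that value fits
      \<open>imag_incr'_eq\<close>.\<close>
    have "y (s2 - s1) \<in> G 0 (ereal (s2 - s1))" using y by (simp add: imag_addits_def)
    from zero_extension[OF _ this] y
    have "imag_incr' G S s y s1 s2
        = E s (T s1 (y (s2 - s1) - T (s2 - s1) (S' (s2 - s1) (y (s2 - s1)))))"
      by (intro imag_incr'_eq) auto
    then show ?thesis using proj_in[OF G] by simp
  qed
  then show "closure (span ?Y) \<subseteq> G 0 (ereal s)"
    using G unfolding closed_subspace_def by (intro closure_minimal span_minimal) auto
qed

end

theorem theorem3p16:
  fixes G :: "real \<Rightarrow> ereal \<Rightarrow> 'a::{real_inner,complete_space} set"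
    and S :: "real \<Rightarrow> 'a \<Rightarrow> 'a"
  assumes "sum_system G S"
  shows "divisible G S"
proof -
  interpret sum_sys G S by unfold_locales fact
  show ?thesis
    unfolding divisible_def using G_eq_closure_real_incr G_eq_closure_imag_incr by blast
qed

end
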